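(* (i) Let $H$ be a Hilbert space and $S$ an isometry on $H$. Then there exist a Hilbert space $\hat H$ containing $H$ and a unitary $\hat S$ on $\hat H$ such that $$\hat S|_H=S,\qquad \overline{\bigcup_{n\ge 0}\hat S^{-n}H}=\hat H.$$ Moreover these are unique up to an intertwining isomorphism. (ii) If, in addition, $\mathcal{A}$ is a $C^*$-algebra, $\alpha$ is an endomorphism of $\mathcal{A}$, and $\pi$ is a representation of $\mathcal{A}$ on $H$ such that $$S\pi(g)=\pi(\alpha(g))S\qquad(g\in\mathcal{A}),$$ then there exists a unique representation $\hat\pi$ of $\mathcal{A}$ on $\hat H$ such that $$\hat\pi(g)|_H=\pi(g)\quad\text{and}\quad \hat S\hat\pi(g)=\hat\pi(\alpha(g))\hat S\qquad(g\in\mathcal{A}).$$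
   Context: Endomorphism means $*$-endomorphism; a representation is a $*$-homomorphism into the bounded operators on a Hilbert space. "$\hat H$ contains $H$" means $H$ is (identified isometrically with) a closed subspace of $\hat H$. "Unique up to an intertwining isomorphism" means that for two such pairs $(\hat H_1,\hat S_1)$, $(\hat H_2,\hat S_2)$ there is a unitary $\hat H_1\to\hat H_2$ that is the identity on $H$ and intertwines $\hat S_1$ and $\hat S_2$. *)

theory Defs
  imports "HOL-Analysis.Analysis" "HOL-Algebra.Algebraic_Closure_Type"
begin

section \<open>Complex Hilbert spaces\<close>

text \<open>
  Hilbert spaces are structures with an explicit carrier, because the dilation theorem asserts the
  existence of one. The underlying vector space is a module of HOL-Algebra over the field of
  complex numbers; the ring multiplication and unit of the module record play no role.
  The inner product is linear in its first argument.
\<close>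

abbreviation complex_field :: "complex ring"
  where "complex_field \<equiv> ring_of_type_algebra"

record 'v inner_space = "(complex, 'v) module" +
  cinner :: "'v \<Rightarrow> 'v \<Rightarrow> complex"

locale complex_inner_space = Module.module complex_field V for V :: "'v inner_space" (structure) +
  assumes cinner_add_left:
      "\<lbrakk>x \<in> carrier V; y \<in> carrier V; z \<in> carrier V\<rbrakk>
        \<Longrightarrow> cinner V (x \<oplus> y) z = cinner V x z + cinner V y z"
    and cinner_smult_left:
      "\<lbrakk>x \<in> carrier V; y \<in> carrier V\<rbrakk> \<Longrightarrow> cinner V (c \<odot> x) y = c * cinner V x y"
    and cinner_commute:
      "\<lbrakk>x \<in> carrier V; y \<in> carrier V\<rbrakk> \<Longrightarrow> cinner V x y = cnj (cinner V y x)"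
    and cinner_nonneg: "x \<in> carrier V \<Longrightarrow> 0 \<le> Re (cinner V x x)"
    and cinner_eq_zero: "\<lbrakk>x \<in> carrier V; cinner V x x = 0\<rbrakk> \<Longrightarrow> x = \<zero>"

definition hnorm :: "'v inner_space \<Rightarrow> 'v \<Rightarrow> real"
  where "hnorm V x = sqrt (Re (cinner V x x))"

text \<open>
  The library's locale of metric spaces requires distances to be symmetric and nonnegative also
  outside the carrier, hence the case distinction.
\<close>

definition hdist :: "'v inner_space \<Rightarrow> 'v \<Rightarrow> 'v \<Rightarrow> real"
  where "hdist V x y = (if x \<in> carrier V \<and> y \<in> carrier V then hnorm V (x \<ominus>\<^bsub>V\<^esub> y) else 0)"

context complex_inner_space
begin

lemma complex_field_simps [simp]:
  "carrier complex_field = UNIV" "\<zero>\<^bsub>complex_field\<^esub> = 0" "\<one>\<^bsub>complex_field\<^esub> = 1"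
  "c \<oplus>\<^bsub>complex_field\<^esub> d = c + d" "c \<otimes>\<^bsub>complex_field\<^esub> d = c * d"
  by (simp_all add: ring_of_type_algebra_def)

lemma smult_in_carrier: "x \<in> carrier V \<Longrightarrow> c \<odot> x \<in> carrier V"
  using smult_closed[of c x] by simp

lemma smult_minus_one: "x \<in> carrier V \<Longrightarrow> (-1) \<odot> x = \<ominus> x"
proof -
  assume x: "x \<in> carrier V"
  have "(1 + (-1)) \<odot> x = x \<oplus> (-1) \<odot> x"
    using smult_l_distr[of 1 "-1" x] smult_one x by simp
  moreover have "(1 + (-1)) \<odot> x = \<zero>"
    using smult_l_null[OF x] by simp
  ultimately show ?thesis
    using x smult_in_carrier by (metis M.add.m_comm M.minus_equality)
qed

lemma cinner_add_right:
  "\<lbrakk>x \<in> carrier V; y \<in> carrier V; z \<in> carrier V\<rbrakk>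
    \<Longrightarrow> cinner V z (x \<oplus> y) = cinner V z x + cinner V z y"
  by (metis cinner_commute cinner_add_left M.add.m_closed complex_cnj_add)

lemma cinner_smult_right:
  "\<lbrakk>x \<in> carrier V; y \<in> carrier V\<rbrakk> \<Longrightarrow> cinner V y (c \<odot> x) = cnj c * cinner V y x"
  by (metis cinner_commute cinner_smult_left smult_in_carrier complex_cnj_mult)

lemma Re_cinner_commute:
  "\<lbrakk>x \<in> carrier V; y \<in> carrier V\<rbrakk> \<Longrightarrow> Re (cinner V x y) = Re (cinner V y x)"
  by (metis cinner_commute cnj.sel(1))

lemma hnorm_power2: "x \<in> carrier V \<Longrightarrow> (hnorm V x)\<^sup>2 = Re (cinner V x x)"
  by (simp add: hnorm_def cinner_nonneg)

lemma hnorm_nonneg: "x \<in> carrier V \<Longrightarrow> 0 \<le> hnorm V x"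
  by (simp add: hnorm_def cinner_nonneg)

lemma cinner_self_Im: "x \<in> carrier V \<Longrightarrow> Im (cinner V x x) = 0"
  by (metis cinner_commute cnj.sel(2) add.inverse_neutral equal_neg_zero)

lemma cinner_zero: "cinner V \<zero> \<zero> = 0"
  using cinner_add_left[of \<zero> \<zero> \<zero>] by simp

lemma hnorm_eq_zero: "x \<in> carrier V \<Longrightarrow> hnorm V x = 0 \<longleftrightarrow> x = \<zero>"
  unfolding hnorm_def
  using cinner_eq_zero cinner_zero cinner_self_Im by (auto simp: complex_eq_iff)

lemma hnorm_add_power2:
  assumes "x \<in> carrier V" "y \<in> carrier V"
  shows "(hnorm V (x \<oplus> y))\<^sup>2 = (hnorm V x)\<^sup>2 + 2 * Re (cinner V x y) + (hnorm V y)\<^sup>2"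
  using assms Re_cinner_commute[of x y]
  by (simp add: hnorm_power2 cinner_add_left cinner_add_right)

lemma hnorm_smult: 
  assumes "x \<in> carrier V" shows "hnorm V (c \<odot> x) = cmod c * hnorm V x"
proof -
  have "cinner V (c \<odot> x) (c \<odot> x) = of_real ((cmod c)\<^sup>2) * cinner V x x"
    using assms smult_in_carrier by (simp add: cinner_smult_left cinner_smult_right
        complex_norm_square mult.assoc[symmetric] del: of_real_power)
  then show ?thesis by (simp add: hnorm_def real_sqrt_mult del: of_real_power)
qed

lemma Re_Cauchy_Schwarz:
  assumes x: "x \<in> carrier V" and y: "y \<in> carrier V"
  shows "\<bar>Re (cinner V x y)\<bar> \<le> hnorm V x * hnorm V y"
proof (cases "hnorm V y = 0")
  case True
  then have "y = \<zero>" using y hnorm_eq_zero by blast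
  then have "cinner V x y = 0" using cinner_add_right[of y y x] x by simp
  then show ?thesis using True by simp
next
  case False
  define b where "b = Re (cinner V x y)"
  define t where "t = - b / (hnorm V y)\<^sup>2"
  have "0 \<le> (hnorm V (x \<oplus> complex_of_real t \<odot> y))\<^sup>2" by simp
  also have "\<dots> = (hnorm V x)\<^sup>2 + 2 * t * b + t\<^sup>2 * (hnorm V y)\<^sup>2"
    using x y smult_in_carrier
    by (simp add: hnorm_add_power2 cinner_smult_right hnorm_smult b_def power_mult_distrib)
  also have "\<dots> = (hnorm V x)\<^sup>2 - b\<^sup>2 / (hnorm V y)\<^sup>2"
    using False by (simp add: t_def power2_eq_square field_simps)
  finally have "b\<^sup>2 \<le> (hnorm V x * hnorm V y)\<^sup>2"
    using False by (simp add: field_simps power_mult_distrib)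
  then show ?thesis
    using x y hnorm_nonneg by (metis b_def abs_le_square_iff abs_of_nonneg mult_nonneg_nonneg)
qed

lemma hnorm_triangle:
  assumes x: "x \<in> carrier V" and y: "y \<in> carrier V"
  shows "hnorm V (x \<oplus> y) \<le> hnorm V x + hnorm V y"
proof -
  have "(hnorm V (x \<oplus> y))\<^sup>2 \<le> (hnorm V x + hnorm V y)\<^sup>2"
    using Re_Cauchy_Schwarz[OF x y] x y by (simp add: hnorm_add_power2 power2_sum)
  then show ?thesis
    using x y hnorm_nonneg by (simp add: power2_le_iff_abs_le)
qed

lemma Metric_space_hdist: "Metric_space (carrier V) (hdist V)"
proof
  fix x y show "0 \<le> hdist V x y" by (simp add: hdist_def hnorm_nonneg)
next
  fix x y show "hdist V x y = hdist V y x"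
  proof (cases "x \<in> carrier V \<and> y \<in> carrier V")
    case True
    then have "y \<ominus> x = (-1) \<odot> (x \<ominus> y)"
      by (simp add: smult_minus_one M.minus_add M.minus_eq M.add.m_comm)
    then show ?thesis using True by (simp add: hdist_def hnorm_smult)
  qed (auto simp: hdist_def)
next
  fix x y assume *: "x \<in> carrier V" "y \<in> carrier V"
  then have "x \<ominus> y = \<zero> \<longleftrightarrow> x = y"
    by (metis M.minus_eq M.r_neg M.minus_minus M.minus_equality M.a_inv_closed)
  then show "hdist V x y = 0 \<longleftrightarrow> x = y"
    using * by (simp add: hdist_def hnorm_eq_zero)
next
  fix x y z assume *: "x \<in> carrier V" "y \<in> carrier V" "z \<in> carrier V"
  then have "x \<ominus> z = (x \<ominus> y) \<oplus> (y \<ominus> z)"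
    by (simp add: M.minus_eq M.add.m_assoc M.r_neg1)
  then show "hdist V x z \<le> hdist V x y + hdist V y z"
    using * hnorm_triangle[of "x \<ominus> y" "y \<ominus> z"] by (simp add: hdist_def)
qed

end

abbreviation htopology :: "'v inner_space \<Rightarrow> 'v topology"
  where "htopology V \<equiv> Metric_space.mtopology (carrier V) (hdist V)"

locale hilbert_space = complex_inner_space +
  assumes complete: "Metric_space.mcomplete (carrier V) (hdist V)"

text \<open>
  Operators are functions on the whole type of which only the values on the carrier matter.
\<close>

definition linear_op :: "'v inner_space \<Rightarrow> 'w inner_space \<Rightarrow> ('v \<Rightarrow> 'w) \<Rightarrow> bool"
  where "linear_op V W T \<longleftrightarrow>
    T \<in> carrier V \<rightarrow> carrier W \<and>
    (\<forall>x\<in>carrier V. \<forall>y\<in>carrier V. T (x \<oplus>\<^bsub>V\<^esub> y) = T x \<oplus>\<^bsub>W\<^esub> T y) \<and>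
    (\<forall>c. \<forall>x\<in>carrier V. T (c \<odot>\<^bsub>V\<^esub> x) = c \<odot>\<^bsub>W\<^esub> T x)"

definition bounded_op :: "'v inner_space \<Rightarrow> ('v \<Rightarrow> 'v) \<Rightarrow> bool"
  where "bounded_op V T \<longleftrightarrow>
    linear_op V V T \<and> (\<exists>B. \<forall>x\<in>carrier V. hnorm V (T x) \<le> B * hnorm V x)"

definition isometry_op :: "'v inner_space \<Rightarrow> 'w inner_space \<Rightarrow> ('v \<Rightarrow> 'w) \<Rightarrow> bool"
  where "isometry_op V W T \<longleftrightarrow>
    linear_op V W T \<and> (\<forall>x\<in>carrier V. hnorm W (T x) = hnorm V x)"

definition unitary_op :: "'v inner_space \<Rightarrow> 'w inner_space \<Rightarrow> ('v \<Rightarrow> 'w) \<Rightarrow> bool"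
  where "unitary_op V W T \<longleftrightarrow> isometry_op V W T \<and> T ` carrier V = carrier W"

section \<open>C*-algebras\<close>

text \<open>
  Not necessarily unital; the norm is submultiplicative and complete by the parent classes.
\<close>

class cstar_algebra = real_normed_algebra + banach +
  fixes scaleC :: "complex \<Rightarrow> 'a \<Rightarrow> 'a"
    and star :: "'a \<Rightarrow> 'a"
  assumes scaleC_add_right: "scaleC c (x + y) = scaleC c x + scaleC c y"
    and scaleC_add_left: "scaleC (c + d) x = scaleC c x + scaleC d x"
    and scaleC_scaleC: "scaleC c (scaleC d x) = scaleC (c * d) x"
    and scaleR_scaleC: "scaleR r x = scaleC (complex_of_real r) x"
    and mult_scaleC_left: "scaleC c x * y = scaleC c (x * y)"
    and mult_scaleC_right: "x * scaleC c y = scaleC c (x * y)"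
    and norm_scaleC: "norm (scaleC c x) = cmod c * norm x"
    and star_star: "star (star x) = x"
    and star_add: "star (x + y) = star x + star y"
    and star_scaleC: "star (scaleC c x) = scaleC (cnj c) (star x)"
    and star_mult: "star (x * y) = star y * star x"
    and cstar_identity: "norm (star x * x) = (norm x)\<^sup>2"

definition star_endomorphism :: "('g::cstar_algebra \<Rightarrow> 'g) \<Rightarrow> bool"
  where "star_endomorphism \<alpha> \<longleftrightarrow>
    (\<forall>f g. \<alpha> (f + g) = \<alpha> f + \<alpha> g) \<and>
    (\<forall>c g. \<alpha> (scaleC c g) = scaleC c (\<alpha> g)) \<and>
    (\<forall>f g. \<alpha> (f * g) = \<alpha> f * \<alpha> g) \<and>
    (\<forall>g. \<alpha> (star g) = star (\<alpha> g))"

text \<open>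
  The last clause says that \<open>\<pi> (star g)\<close> is the Hilbert space adjoint of \<open>\<pi> g\<close>.
  Representations may be degenerate.
\<close>

definition star_representation :: "'v inner_space \<Rightarrow> ('g::cstar_algebra \<Rightarrow> 'v \<Rightarrow> 'v) \<Rightarrow> bool"
  where "star_representation V \<pi> \<longleftrightarrow>
    (\<forall>g. bounded_op V (\<pi> g)) \<and>
    (\<forall>f g. \<forall>x\<in>carrier V. \<pi> (f + g) x = \<pi> f x \<oplus>\<^bsub>V\<^esub> \<pi> g x) \<and>
    (\<forall>c g. \<forall>x\<in>carrier V. \<pi> (scaleC c g) x = c \<odot>\<^bsub>V\<^esub> \<pi> g x) \<and>
    (\<forall>f g. \<forall>x\<in>carrier V. \<pi> (f * g) x = \<pi> f (\<pi> g x)) \<and>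
    (\<forall>g. \<forall>x\<in>carrier V. \<forall>y\<in>carrier V. cinner V (\<pi> (star g) x) y = cinner V x (\<pi> g y))"

text \<open>\<open>S \<pi>(g) = \<pi>(\<alpha>(g)) S\<close> for all \<open>g\<close>, as operators on \<open>V\<close>.\<close>

definition covariant ::
    "'v inner_space \<Rightarrow> ('v \<Rightarrow> 'v) \<Rightarrow> ('g \<Rightarrow> 'g) \<Rightarrow> ('g \<Rightarrow> 'v \<Rightarrow> 'v) \<Rightarrow> bool"
  where "covariant V S \<alpha> \<pi> \<longleftrightarrow> (\<forall>g. \<forall>x\<in>carrier V. S (\<pi> g x) = \<pi> (\<alpha> g) (S x))"

section \<open>Unitary extensions of an isometry\<close>

text \<open>
  \<open>J\<close> is the isometric identification of \<open>H\<close> with a closed subspace of \<open>K\<close>.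
\<close>

definition contains_via :: "'k inner_space \<Rightarrow> ('h \<Rightarrow> 'k) \<Rightarrow> 'h inner_space \<Rightarrow> bool"
  where "contains_via K J H \<longleftrightarrow> isometry_op H K J \<and> closedin (htopology K) (J ` carrier H)"

definition minimal_unitary_extension ::
    "'h inner_space \<Rightarrow> ('h \<Rightarrow> 'h) \<Rightarrow> 'k inner_space \<Rightarrow> ('h \<Rightarrow> 'k) \<Rightarrow> ('k \<Rightarrow> 'k) \<Rightarrow> bool"
  where "minimal_unitary_extension H S K J U \<longleftrightarrow>
    hilbert_space K \<and> contains_via K J H \<and> unitary_op K K U \<and>
    (\<forall>x\<in>carrier H. U (J x) = J (S x)) \<and>
    htopology K closure_of (\<Union>n. (inv_into (carrier K) U ^^ n) ` J ` carrier H) = carrier K"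

end

theory Submission
  imports Defs
begin

text \<open>
  If \<open>K\<close>, \<open>U\<close> is a minimal unitary extension of \<open>S\<close> and \<open>P\<close> is the projection onto \<open>H\<close>, then a
  vector \<open>y\<close> of \<open>K\<close> is determined by the sequence of the vectors \<open>x n = P (U^n y)\<close>, which is bounded,
  satisfies \<open>S* x (n + 1) = x n\<close>, and has \<open>norm y = lim (norm (x n))\<close>. Conversely, the bounded
  sequences in \<open>H\<close> with \<open>S* x (n + 1) = x n\<close>, with the limit inner product and the left shift, form a
  minimal unitary extension in which \<open>h\<close> is represented by the sequence of the \<open>S^n h\<close>. So every
  minimal unitary extension is canonically isomorphic to this one, on which the extended representation acts by
  \<open>(g x) n = \<pi> (\<alpha>^n g) (x n)\<close>. The result is bounded because each \<open>\<pi> \<circ> \<alpha>^n\<close> is a representation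
  and representations of C*-algebras are contractive.
\<close>

subsection \<open>Inner product spaces and convergence\<close>

text \<open>The dilation is usually obtained by completing a direct limit of copies of H, whose
  vectors are equivalence classes. Recording y by the projections of all U^n y gives each vector a
  single representative, of type \<open>nat => 'h\<close>, and completeness is inherited from H
  coordinate by coordinate. Coherence makes the norms of the coordinates increase, since S* is a
  contraction; with boundedness this yields the limit of the norms, and polarisation then yields the
  limit of the inner products. Minimality is what makes the norm of y the full limit: U^n y comes
  arbitrarily close to H, where projecting loses nothing. The sequence of the \<pi> (\<alpha>^n g)
  (x n) is coherent because this condition is the adjoint of the covariance relation. For it to be
  bounded, separate bounds for the operators \<pi> (\<alpha>^n g) do not suffice; one constant for
  all n is required, and norm g is such a constant.\<close>

context complex_inner_space
begin

lemma cinner_minus_left: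
  assumes "x \<in> carrier V" "z \<in> carrier V"
  shows "cinner V (\<ominus> x) z = - cinner V x z"
  using cinner_smult_left[OF assms, of "-1"] smult_minus_one[OF assms(1)] by simp

lemma cinner_diff_left:
  assumes "x \<in> carrier V" "y \<in> carrier V" "z \<in> carrier V"
  shows "cinner V (x \<ominus> y) z = cinner V x z - cinner V y z"
  using assms by (simp add: M.minus_eq cinner_add_left cinner_minus_left)

lemma cinner_diff_right:
  assumes "x \<in> carrier V" "y \<in> carrier V" "z \<in> carrier V"
  shows "cinner V z (x \<ominus> y) = cinner V z x - cinner V z y"
  using cinner_diff_left[OF assms] cinner_commute assms by (metis M.minus_closed complex_cnj_diff)

lemma diff_eq_zero:
  assumes "x \<in> carrier V" "y \<in> carrier V" "x \<ominus> y = \<zero>"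
  shows "x = y"
  using assms by (metis M.minus_eq M.r_neg M.minus_minus M.minus_equality M.a_inv_closed)

lemma cinner_eqI:
  assumes "x \<in> carrier V" "y \<in> carrier V"
    and "\<And>z. z \<in> carrier V \<Longrightarrow> cinner V x z = cinner V y z"
  shows "x = y"
proof -
  have "cinner V (x \<ominus> y) (x \<ominus> y) = 0"
    using assms by (simp add: cinner_diff_left)
  then show ?thesis using assms cinner_eq_zero diff_eq_zero by simp
qed

lemma hnorm_diff_power2:
  assumes "x \<in> carrier V" "y \<in> carrier V"
  shows "(hnorm V (x \<ominus> y))\<^sup>2 = (hnorm V x)\<^sup>2 - 2 * Re (cinner V x y) + (hnorm V y)\<^sup>2"
  using assms Re_cinner_commute[of x y]
  by (simp add: hnorm_power2 cinner_diff_left cinner_diff_right)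

lemma hnorm_zero [simp]: "hnorm V \<zero> = 0"
  by (simp add: hnorm_eq_zero)

lemma hnorm_diff_commute:
  assumes "x \<in> carrier V" "y \<in> carrier V"
  shows "hnorm V (x \<ominus> y) = hnorm V (y \<ominus> x)"
proof -
  have "(hnorm V (x \<ominus> y))\<^sup>2 = (hnorm V (y \<ominus> x))\<^sup>2"
    using assms Re_cinner_commute[of x y] by (simp add: hnorm_diff_power2)
  then show ?thesis using assms by (simp add: hnorm_nonneg)
qed

lemma hnorm_diff_triangle:
  assumes "x \<in> carrier V" "y \<in> carrier V" "z \<in> carrier V"
  shows "hnorm V (x \<ominus> z) \<le> hnorm V (x \<ominus> y) + hnorm V (y \<ominus> z)"
proof -
  have "x \<ominus> z = (x \<ominus> y) \<oplus> (y \<ominus> z)"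
    using assms by (simp add: M.minus_eq M.add.m_assoc M.r_neg1)
  then show ?thesis using hnorm_triangle[of "x \<ominus> y" "y \<ominus> z"] assms by simp
qed

lemma diff_zero_right: "x \<in> carrier V \<Longrightarrow> x \<ominus> \<zero> = x"
  by (simp add: M.minus_eq)

lemma hnorm_triangle_ineq2:
  assumes "x \<in> carrier V" "y \<in> carrier V"
  shows "\<bar>hnorm V x - hnorm V y\<bar> \<le> hnorm V (x \<ominus> y)"
  using hnorm_diff_triangle[of x y \<zero>] hnorm_diff_triangle[of y x \<zero>] assms
  by (simp add: diff_zero_right hnorm_diff_commute[of y x])

text \<open>Carries facts about norms over to inner products: for isometries, and for the limit form
  on coherent sequences.\<close>

lemma Re_cinner_polar:
  assumes "x \<in> carrier V" "y \<in> carrier V"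
  shows "Re (cinner V x y) = ((hnorm V (x \<oplus> y))\<^sup>2 - (hnorm V (x \<ominus> y))\<^sup>2) / 4"
  using assms by (simp add: hnorm_add_power2 hnorm_diff_power2)

text \<open>Conjugate linearity in the second argument turns \<i> into -\<i>, and Re (-\<i> z) = Im
  z. Complex statements thus follow from their real parts at y and \<i> y.\<close>

lemma Im_cinner:
  assumes "x \<in> carrier V" "y \<in> carrier V"
  shows "Im (cinner V x y) = Re (cinner V x (\<i> \<odot> y))"
  using assms by (simp add: cinner_smult_right)

text \<open>The factor 2 comes from bounding real and imaginary parts separately; any constant
  serves for the continuity of the inner product.\<close>

lemma cmod_cinner_le:
  assumes x: "x \<in> carrier V" and y: "y \<in> carrier V"
  shows "cmod (cinner V x y) \<le> 2 * (hnorm V x * hnorm V y)"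
proof -
  have "\<bar>Im (cinner V x y)\<bar> \<le> hnorm V x * hnorm V y"
    using Re_Cauchy_Schwarz[OF x smult_in_carrier[OF y], of \<i>] Im_cinner[OF x y]
    by (simp add: hnorm_smult[OF y])
  then show ?thesis
    using Re_Cauchy_Schwarz[OF x y] cmod_le[of "cinner V x y"] by linarith
qed

lemma parallelogram:
  assumes "x \<in> carrier V" "y \<in> carrier V"
  shows "(hnorm V (x \<oplus> y))\<^sup>2 + (hnorm V (x \<ominus> y))\<^sup>2 = 2 * (hnorm V x)\<^sup>2 + 2 * (hnorm V y)\<^sup>2"
  using assms by (simp add: hnorm_add_power2 hnorm_diff_power2)

section \<open>Limits, Cauchy sequences and closures in terms of the norm\<close>

lemma limitin_htopology_iff:
  assumes "\<And>n. s n \<in> carrier V"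
  shows "limitin (htopology V) s x sequentially
    \<longleftrightarrow> x \<in> carrier V \<and> (\<lambda>n. hnorm V (s n \<ominus> x)) \<longlonglongrightarrow> 0"
proof (cases "x \<in> carrier V")
  case True
  then show ?thesis
    using assms by (simp add: Metric_space.limitin_metric_dist_null[OF Metric_space_hdist] hdist_def)
qed (simp add: Metric_space.limitin_metric_dist_null[OF Metric_space_hdist])

lemma MCauchy_hdist_iff:
  "Metric_space.MCauchy (carrier V) (hdist V) s \<longleftrightarrow> range s \<subseteq> carrier V \<and>
    (\<forall>e>0. \<exists>N. \<forall>m\<ge>N. \<forall>n\<ge>N. hnorm V (s m \<ominus> s n) < e)"
  unfolding Metric_space.MCauchy_def[OF Metric_space_hdist]
  by (auto simp: hdist_def range_subsetD)

lemma htopology_closure_eq: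
  "htopology V closure_of D
    = {x \<in> carrier V. \<forall>e>0. \<exists>y\<in>D \<inter> carrier V. hnorm V (x \<ominus> y) < e}"
  unfolding Metric_space.metric_closure_of[OF Metric_space_hdist]
  by (auto simp: Metric_space.in_mball[OF Metric_space_hdist] hdist_def) 

lemma cinner_tendsto_left:
  assumes s: "\<And>n. s n \<in> carrier V" and x: "x \<in> carrier V" and z: "z \<in> carrier V"
    and lim: "(\<lambda>n. hnorm V (s n \<ominus> x)) \<longlonglongrightarrow> 0"
  shows "(\<lambda>n. cinner V (s n) z) \<longlonglongrightarrow> cinner V x z"
proof (rule LIM_zero_cancel, rule tendsto_0_le[where K = "2 * hnorm V z"])
  show "(\<lambda>n. hnorm V (s n \<ominus> x)) \<longlonglongrightarrow> 0" by (rule lim)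
  show "\<forall>\<^sub>F n in sequentially. norm (cinner V (s n) z - cinner V x z)
      \<le> norm (hnorm V (s n \<ominus> x)) * (2 * hnorm V z)"
    using cmod_cinner_le[of "s _ \<ominus> x" z] s x z
    by (intro always_eventually) (simp add: cinner_diff_left hnorm_nonneg mult_ac)
qed

lemma hnorm_tendsto:
  assumes s: "\<And>n. s n \<in> carrier V" and x: "x \<in> carrier V"
    and lim: "(\<lambda>n. hnorm V (s n \<ominus> x)) \<longlonglongrightarrow> 0"
  shows "(\<lambda>n. hnorm V (s n)) \<longlonglongrightarrow> hnorm V x"
proof (rule LIM_zero_cancel, rule tendsto_0_le[where K = 1])
  show "(\<lambda>n. hnorm V (s n \<ominus> x)) \<longlonglongrightarrow> 0" by (rule lim)
  show "\<forall>\<^sub>F n in sequentially. norm (hnorm V (s n) - hnorm V x)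
      \<le> norm (hnorm V (s n \<ominus> x)) * 1"
    using hnorm_triangle_ineq2[of "s _" x] s x
    by (intro always_eventually) (simp add: hnorm_nonneg)
qed

end

lemma (in hilbert_space) Cauchy_converges:
  assumes "\<And>n. s n \<in> carrier V"
    and "\<And>e. 0 < e \<Longrightarrow> \<exists>N. \<forall>m\<ge>N. \<forall>n\<ge>N. hnorm V (s m \<ominus> s n) < e"
  obtains x where "x \<in> carrier V" "(\<lambda>n. hnorm V (s n \<ominus> x)) \<longlonglongrightarrow> 0"
proof -
  have "Metric_space.MCauchy (carrier V) (hdist V) s"
    using assms by (auto simp: MCauchy_hdist_iff)
  then obtain x where "limitin (htopology V) s x sequentially"
    using complete Metric_space.mcomplete_def[OF Metric_space_hdist] by metis
  then show ?thesis
    using limitin_htopology_iff[of s x] assms(1) by (auto intro!: that)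
qed

lemma hilbert_spaceI:
  assumes "complex_inner_space V"
    and "\<And>s. \<lbrakk>\<And>n. s n \<in> carrier V;
          \<And>e. 0 < e \<Longrightarrow> \<exists>N. \<forall>m\<ge>N. \<forall>n\<ge>N. hnorm V (s m \<ominus>\<^bsub>V\<^esub> s n) < e\<rbrakk>
        \<Longrightarrow> \<exists>x\<in>carrier V. (\<lambda>n. hnorm V (s n \<ominus>\<^bsub>V\<^esub> x)) \<longlonglongrightarrow> 0"
  shows "hilbert_space V"
proof -
  interpret complex_inner_space V by fact
  show ?thesis
  proof
    show "Metric_space.mcomplete (carrier V) (hdist V)"
      unfolding Metric_space.mcomplete_def[OF Metric_space_hdist]
    proof (intro allI impI)
      fix s assume "Metric_space.MCauchy (carrier V) (hdist V) s"
      then have *: "\<And>n. s n \<in> carrier V"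
          "\<And>e. 0 < e \<Longrightarrow> \<exists>N. \<forall>m\<ge>N. \<forall>n\<ge>N. hnorm V (s m \<ominus>\<^bsub>V\<^esub> s n) < e"
        by (auto simp: MCauchy_hdist_iff)
      then have "\<exists>x\<in>carrier V. (\<lambda>n. hnorm V (s n \<ominus>\<^bsub>V\<^esub> x)) \<longlonglongrightarrow> 0"
        by (rule assms(2))
      then show "\<exists>x. limitin (htopology V) s x sequentially"
        using limitin_htopology_iff[of s] *(1) by blast
    qed
  qed
qed

subsection \<open>Riesz representation and adjoints\<close>

text \<open>Direct method: v is found as the minimiser of |v|^2 - 2 \<phi> v, which differs by a
  constant from the squared distance to the representing vector. Only real linearity is assumed, so
  that \<phi> may be the real part of a complex functional.\<close>

lemma (in hilbert_space) Riesz_representation_Re: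
  assumes add: "\<And>x y. \<lbrakk>x \<in> carrier V; y \<in> carrier V\<rbrakk> \<Longrightarrow> \<phi> (x \<oplus> y) = \<phi> x + \<phi> y"
    and smult: "\<And>x r. x \<in> carrier V \<Longrightarrow> \<phi> (complex_of_real r \<odot> x) = r * \<phi> x"
    and bound: "\<And>x. x \<in> carrier V \<Longrightarrow> \<bar>\<phi> x\<bar> \<le> B * hnorm V x"
  shows "\<exists>v\<in>carrier V. \<forall>x\<in>carrier V. Re (cinner V v x) = \<phi> x"
proof -
  define f where "f v = (hnorm V v)\<^sup>2 - 2 * \<phi> v" for v
  have minus: "\<phi> (\<ominus> x) = - \<phi> x" if "x \<in> carrier V" for x
    using smult[OF that, of "-1"] smult_minus_one[OF that] by simp
  have diff: "\<phi> (x \<ominus> y) = \<phi> x - \<phi> y" if "x \<in> carrier V" "y \<in> carrier V" for x y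
    using that by (simp add: M.minus_eq add minus)
  \<comment> \<open>The bound on \<phi> gives f v \<ge> (|v| - B)^2 - B^2.\<close>
  have "- B\<^sup>2 \<le> f v" if "v \<in> carrier V" for v
  proof -
    have "\<phi> v \<le> B * hnorm V v" using bound[OF that] by linarith
    then show ?thesis
      using zero_le_power2[of "hnorm V v - B"] by (simp add: f_def power2_diff algebra_simps)
  qed
  then have bdd: "bdd_below (f ` carrier V)" by (auto intro!: bdd_belowI2)
  define m where "m = Inf (f ` carrier V)"
  have m_le: "m \<le> f v" if "v \<in> carrier V" for v
    unfolding m_def using bdd that by (simp add: cINF_lower)
  have "\<exists>v\<in>carrier V. f v < m + 1 / Suc n" for n
  proof -
    have "Inf (f ` carrier V) < m + 1 / Suc n" by (simp add: m_def)
    then show ?thesis using cINF_less_iff[OF _ bdd] by (metis M.zero_closed empty_iff)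
  qed
  then obtain s where s: "\<And>n. s n \<in> carrier V" "\<And>n. f (s n) < m + 1 / Suc n" by metis
  \<comment> \<open>By the parallelogram law the mean of f u and f v exceeds the value at the
    midpoint by |u - v|^2 / 4, and that value is at least m. Hence minimising sequences are
    Cauchy.\<close>
  have est: "(hnorm V (u \<ominus> v))\<^sup>2 \<le> 2 * (f u - m) + 2 * (f v - m)"
    if u: "u \<in> carrier V" and v: "v \<in> carrier V" for u v
  proof -
    have "m \<le> f (complex_of_real (1/2) \<odot> (u \<oplus> v))" using u v by (intro m_le smult_in_carrier) simp
    also have "\<dots> = (hnorm V (u \<oplus> v))\<^sup>2 / 4 - (\<phi> u + \<phi> v)"
      using u v by (simp only: f_def smult hnorm_smult M.add.m_closed add)
          (simp add: power_divide)
    finally show ?thesis using parallelogram[OF u v] by (simp add: f_def)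
  qed
  have "\<exists>N. \<forall>m\<ge>N. \<forall>n\<ge>N. hnorm V (s m \<ominus> s n) < e" if "0 < e" for e
  proof -
    \<comment> \<open>\<open>est\<close> bounds the squared distance by 2 / Suc a + 2 / Suc b, at
      most 4 / Suc N.\<close>
    obtain N where N: "4 / e\<^sup>2 < real (Suc N)"
      using reals_Archimedean2[of "4 / e\<^sup>2"] by (meson less_trans of_nat_less_iff lessI)
    have "hnorm V (s a \<ominus> s b) < e" if "a \<ge> N" "b \<ge> N" for a b
    proof -
      have "1 / real (Suc a) \<le> 1 / real (Suc N)" "1 / real (Suc b) \<le> 1 / real (Suc N)"
        using that by (auto simp: frac_le)
      then have "(hnorm V (s a \<ominus> s b))\<^sup>2 < 4 / real (Suc N)"
        using est[OF s(1) s(1), of a b] s(2)[of a] s(2)[of b] by simp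
      also have "\<dots> < e\<^sup>2" using N \<open>0 < e\<close> by (simp add: field_simps)
      finally show ?thesis using \<open>0 < e\<close> by (simp add: power2_less_imp_less)
    qed
    then show ?thesis by blast
  qed
  with s(1) obtain v where v: "v \<in> carrier V" and lim: "(\<lambda>n. hnorm V (s n \<ominus> v)) \<longlonglongrightarrow> 0"
    by (rule Cauchy_converges)
  have "(\<lambda>n. \<phi> (s n)) \<longlonglongrightarrow> \<phi> v"
  proof (rule LIM_zero_cancel, rule tendsto_0_le[where K = "\<bar>B\<bar>"])
    have "\<bar>\<phi> (s n \<ominus> v)\<bar> \<le> \<bar>B\<bar> * hnorm V (s n \<ominus> v)" for n
      using bound[of "s n \<ominus> v"] s(1)[of n] v
      by (smt (verit) M.minus_closed hnorm_nonneg mult_right_mono)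
    then show "\<forall>\<^sub>F n in sequentially. norm (\<phi> (s n) - \<phi> v) \<le> norm (hnorm V (s n \<ominus> v)) * \<bar>B\<bar>"
      using s(1) v by (intro always_eventually) (simp add: diff hnorm_nonneg mult.commute)
  qed (rule lim)
  then have "(\<lambda>n. f (s n)) \<longlonglongrightarrow> f v"
    unfolding f_def using hnorm_tendsto[OF s(1) v lim] by (intro tendsto_intros)
  moreover have "(\<lambda>n. m + 1 / Suc n) \<longlonglongrightarrow> m + 0"
    using LIMSEQ_inverse_real_of_nat by (intro tendsto_intros) (simp add: inverse_eq_divide)
  ultimately have "f v \<le> m"
    using s(2) LIMSEQ_le[of "\<lambda>n. f (s n)" "f v" "\<lambda>n. m + 1 / Suc n" m] less_imp_le by auto
  have "Re (cinner V v x) = \<phi> x" if x: "x \<in> carrier V" for x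
  proof -
    define c where "c = Re (cinner V v x) - \<phi> x"
    \<comment> \<open>The right side is f (v + t x) - f v. A quadratic in t without constant term
      that is never negative has zero linear coefficient.\<close>
    have quad: "0 \<le> t\<^sup>2 * (hnorm V x)\<^sup>2 + 2 * t * c" for t
    proof -
      have "f v \<le> f (v \<oplus> complex_of_real t \<odot> x)"
        using \<open>f v \<le> m\<close> m_le[of "v \<oplus> complex_of_real t \<odot> x"] v x smult_in_carrier
        by (meson M.add.m_closed order_trans)
      then show ?thesis
        using v x smult_in_carrier
        by (simp add: f_def hnorm_add_power2 cinner_smult_right hnorm_smult power_mult_distrib
            add smult c_def algebra_simps)
    qed
    have "c = 0"
    proof (rule ccontr)
      assume "c \<noteq> 0"
      \<comment> \<open>At t = - c / q the quadratic is negative if c is nonzero; the added 1 keeps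
        q positive when x is zero.\<close>
      define q where "q = (hnorm V x)\<^sup>2 + 1"
      have "0 \<le> (- c / q)\<^sup>2 * (q - 1) + 2 * (- c / q) * c"
        using quad[of "- c / q"] by (simp add: q_def)
      moreover have "0 < q" by (simp add: q_def add_nonneg_pos)
      moreover have "(- c / q)\<^sup>2 * (q - 1) + 2 * (- c / q) * c = - (c\<^sup>2 * (q + 1) / q\<^sup>2)"
        using calculation(2) by (simp add: power2_eq_square divide_simps) (simp add: algebra_simps)
      moreover have "0 < c\<^sup>2 * (q + 1) / q\<^sup>2"
        using calculation(2) \<open>c \<noteq> 0\<close> by simp
      ultimately show False by linarith
    qed
    then show ?thesis by (simp add: c_def)
  qed
  then show ?thesis using v by blast
qed

lemma linear_opD:
  assumes "linear_op V W T"
  shows "x \<in> carrier V \<Longrightarrow> T x \<in> carrier W"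
    "\<lbrakk>x \<in> carrier V; y \<in> carrier V\<rbrakk> \<Longrightarrow> T (x \<oplus>\<^bsub>V\<^esub> y) = T x \<oplus>\<^bsub>W\<^esub> T y"
    "x \<in> carrier V \<Longrightarrow> T (c \<odot>\<^bsub>V\<^esub> x) = c \<odot>\<^bsub>W\<^esub> T x"
  using assms by (auto simp: linear_op_def)

lemma linear_op_diff:
  assumes "complex_inner_space V" "complex_inner_space W" "linear_op V W T"
    and "x \<in> carrier V" "y \<in> carrier V"
  shows "T (x \<ominus>\<^bsub>V\<^esub> y) = T x \<ominus>\<^bsub>W\<^esub> T y"
proof -
  interpret V: complex_inner_space V by fact
  interpret W: complex_inner_space W by fact
  note T = linear_opD[OF assms(3)]
  show ?thesis
    using assms(4,5) T V.smult_in_carrier[of y "-1"]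
    by (simp add: V.M.minus_eq W.M.minus_eq flip: V.smult_minus_one W.smult_minus_one)
qed

text \<open>The choice is meaningful wherever \<open>adj_props\<close> supplies a witness. For the
  embedding J of H in K, the adjoint is the projection onto the image of H followed by the inverse
  of J.\<close>

definition adj :: "'v inner_space \<Rightarrow> 'w inner_space \<Rightarrow> ('v \<Rightarrow> 'w) \<Rightarrow> 'w \<Rightarrow> 'v"
  where "adj V W T w =
    (SOME v. v \<in> carrier V \<and> (\<forall>x\<in>carrier V. cinner V v x = cinner W w (T x)))"

text \<open>Riesz representation of the real part of the functional, bounded by the norm of w as T
  is isometric; evaluating at \<i> x recovers the imaginary part.\<close>

lemma adj_props:
  assumes "hilbert_space V" "complex_inner_space W" "isometry_op V W T" and w: "w \<in> carrier W"
  shows "adj V W T w \<in> carrier V \<and>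
    (\<forall>x\<in>carrier V. cinner V (adj V W T w) x = cinner W w (T x))"
  unfolding adj_def
proof (rule someI_ex)
  interpret V: hilbert_space V by fact
  interpret W: complex_inner_space W by fact
  have lin: "linear_op V W T" and nrm: "\<And>x. x \<in> carrier V \<Longrightarrow> hnorm W (T x) = hnorm V x"
    using assms(3) by (auto simp: isometry_op_def)
  note T = linear_opD[OF lin]
  have "\<exists>v\<in>carrier V. \<forall>x\<in>carrier V. Re (cinner V v x) = Re (cinner W w (T x))"
  proof (rule V.Riesz_representation_Re[where B = "hnorm W w"])
    fix x assume x: "x \<in> carrier V"
    then show "\<bar>Re (cinner W w (T x))\<bar> \<le> hnorm W w * hnorm V x"
      using W.Re_Cauchy_Schwarz[OF w T(1)[OF x]] nrm by simp
  qed (simp_all add: T w W.cinner_add_right W.cinner_smult_right)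
  then obtain v where v: "v \<in> carrier V"
      "\<And>x. x \<in> carrier V \<Longrightarrow> Re (cinner V v x) = Re (cinner W w (T x))"
    by blast
  have "cinner V v x = cinner W w (T x)" if x: "x \<in> carrier V" for x
    using v x T w V.smult_in_carrier
    by (simp add: complex_eq_iff V.Im_cinner W.Im_cinner)
  with v show "\<exists>v. v \<in> carrier V \<and> (\<forall>x\<in>carrier V. cinner V v x = cinner W w (T x))"
    by blast
qed

subsection \<open>Isometries\<close>

lemma isometry_opD:
  assumes "isometry_op V W T"
  shows "linear_op V W T" "x \<in> carrier V \<Longrightarrow> hnorm W (T x) = hnorm V x"
  using assms by (auto simp: isometry_op_def)

locale isometry_between = V: complex_inner_space V + W: complex_inner_space W
  for V :: "'v inner_space" and W :: "'w inner_space" +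
  fixes T :: "'v \<Rightarrow> 'w"
  assumes isometry: "isometry_op V W T"
begin

lemmas linear = isometry_opD(1)[OF isometry]
lemmas T_closed [simp] = linear_opD(1)[OF linear]
lemmas T_add = linear_opD(2)[OF linear]
lemmas T_smult = linear_opD(3)[OF linear]
lemmas T_norm [simp] = isometry_opD(2)[OF isometry]
lemmas T_diff = linear_op_diff[OF V.complex_inner_space_axioms W.complex_inner_space_axioms linear]

text \<open>An isometry is only required to preserve norms; polarisation gives the real part and
  \<i> y the imaginary part.\<close>

lemma T_cinner:
  assumes x: "x \<in> carrier V" and y: "y \<in> carrier V"
  shows "cinner W (T x) (T y) = cinner V x y"
proof -
  have Re: "Re (cinner W (T x) (T y)) = Re (cinner V x y)" if "y \<in> carrier V" for y
  proof -
    have "hnorm W (T x \<oplus>\<^bsub>W\<^esub> T y) = hnorm V (x \<oplus>\<^bsub>V\<^esub> y)"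
      using x that by (metis T_add T_norm V.M.add.m_closed)
    moreover have "hnorm W (T x \<ominus>\<^bsub>W\<^esub> T y) = hnorm V (x \<ominus>\<^bsub>V\<^esub> y)"
      using x that by (metis T_diff T_norm V.M.minus_closed)
    ultimately show ?thesis using x that by (simp add: V.Re_cinner_polar W.Re_cinner_polar)
  qed
  then show ?thesis
    using x y Re[OF V.smult_in_carrier[OF y]]
    by (simp add: complex_eq_iff V.Im_cinner W.Im_cinner T_smult)
qed

lemma T_inj: "inj_on T (carrier V)"
proof (rule inj_onI)
  fix x y assume xy: "x \<in> carrier V" "y \<in> carrier V" "T x = T y"
  then have "cinner V x z = cinner V y z" if "z \<in> carrier V" for z
    using that by (metis T_cinner)
  then show "x = y" using xy V.cinner_eqI by blast
qed

end

locale hilbert_isometry = V: hilbert_space V + isometry_between V W T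
  for V :: "'v inner_space" and W :: "'w inner_space" and T
begin

abbreviation adjoint ("T\<^sup>*") where "T\<^sup>* \<equiv> adj V W T"

lemma adj_closed [simp]: "w \<in> carrier W \<Longrightarrow> T\<^sup>* w \<in> carrier V"
  and cinner_adj: "\<lbrakk>w \<in> carrier W; x \<in> carrier V\<rbrakk> \<Longrightarrow> cinner V (T\<^sup>* w) x = cinner W w (T x)"
  using adj_props[OF V.hilbert_space_axioms W.complex_inner_space_axioms isometry] by blast+

lemma adj_eqI:
  assumes "w \<in> carrier W" "v \<in> carrier V"
    and "\<And>x. x \<in> carrier V \<Longrightarrow> cinner V v x = cinner W w (T x)"
  shows "T\<^sup>* w = v"
  using assms by (intro V.cinner_eqI) (auto simp: cinner_adj)

lemma adj_apply: "v \<in> carrier V \<Longrightarrow> T\<^sup>* (T v) = v"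
  by (rule adj_eqI) (auto simp: T_cinner)

lemma linear_adj: "linear_op W V T\<^sup>*"
  unfolding linear_op_def
  by (auto intro!: adj_eqI simp: cinner_adj V.cinner_add_left W.cinner_add_left
      V.cinner_smult_left W.cinner_smult_left V.smult_in_carrier W.smult_in_carrier)

text \<open>Cauchy-Schwarz in |T* w|^2 = Re (w, T T* w), where T T* w has the norm of T* w; then one
  factor cancels.\<close>

lemma hnorm_adj_le:
  assumes w: "w \<in> carrier W"
  shows "hnorm V (T\<^sup>* w) \<le> hnorm W w"
proof -
  have "(hnorm V (T\<^sup>* w))\<^sup>2 = Re (cinner W w (T (T\<^sup>* w)))"
    using w by (simp add: V.hnorm_power2 cinner_adj)
  also have "\<dots> \<le> hnorm W w * hnorm V (T\<^sup>* w)"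
    using W.Re_Cauchy_Schwarz[OF w T_closed[OF adj_closed[OF w]]] w by simp
  finally show ?thesis
    using V.hnorm_nonneg[OF adj_closed[OF w]] W.hnorm_nonneg[OF w]
    by (cases "hnorm V (T\<^sup>* w) = 0") (auto simp: power2_eq_square)
qed

text \<open>The preimages of a convergent sequence are Cauchy, and V is complete. This gives
  closedness of the copy of H in the dilation, and later surjectivity of \<open>\<Phi>\<close> from
  density of its range.\<close>

lemma closedin_range: "closedin (htopology W) (T ` carrier V)"
  unfolding Metric_space.metric_closedin_iff_sequentially_closed[OF W.Metric_space_hdist]
proof (intro conjI allI impI)
  show "T ` carrier V \<subseteq> carrier W" by auto
next
  fix s l assume s: "range s \<subseteq> T ` carrier V \<and> limitin (htopology W) s l sequentially"
  then have "\<forall>n. \<exists>x\<in>carrier V. s n = T x" by blast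
  then obtain x where x: "\<And>n. x n \<in> carrier V" "\<And>n. s n = T (x n)" by metis
  then have sW: "\<And>n. s n \<in> carrier W" by simp
  then have l: "l \<in> carrier W" and lim: "(\<lambda>n. hnorm W (s n \<ominus>\<^bsub>W\<^esub> l)) \<longlonglongrightarrow> 0"
    using s W.limitin_htopology_iff[of s l] by auto
  have "\<exists>N. \<forall>m\<ge>N. \<forall>n\<ge>N. hnorm V (x m \<ominus>\<^bsub>V\<^esub> x n) < e" if "0 < e" for e
  proof -
    obtain N where N: "\<And>n. n \<ge> N \<Longrightarrow> hnorm W (s n \<ominus>\<^bsub>W\<^esub> l) < e / 2"
      using order_tendstoD(2)[OF lim, of "e / 2"] \<open>0 < e\<close> by (auto simp: eventually_sequentially)
    have "hnorm V (x m \<ominus>\<^bsub>V\<^esub> x n) < e" if "m \<ge> N" "n \<ge> N" for m n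
    proof -
      have "hnorm V (x m \<ominus>\<^bsub>V\<^esub> x n) = hnorm W (s m \<ominus>\<^bsub>W\<^esub> s n)"
        by (metis T_diff T_norm V.M.minus_closed x)
      then show ?thesis
        using N[OF that(1)] N[OF that(2)] W.hnorm_diff_triangle[OF sW l sW, of m n]
          W.hnorm_diff_commute[OF l sW, of n] by simp
    qed
    then show ?thesis by blast
  qed
  with x(1) obtain v where v: "v \<in> carrier V" and "(\<lambda>n. hnorm V (x n \<ominus>\<^bsub>V\<^esub> v)) \<longlonglongrightarrow> 0"
    by (rule V.Cauchy_converges)
  moreover have "hnorm W (s n \<ominus>\<^bsub>W\<^esub> T v) = hnorm V (x n \<ominus>\<^bsub>V\<^esub> v)" for n
    by (metis T_diff T_norm V.M.minus_closed x v)
  ultimately have "limitin (htopology W) s (T v) sequentially"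
    using W.limitin_htopology_iff[of s "T v"] sW by simp
  then show "l \<in> T ` carrier V"
    using s v Metric_space.limitin_metric_unique[OF W.Metric_space_hdist] by fastforce
qed

end

subsection \<open>The space of bounded coherent sequences\<close>

text \<open>The second clause says \<open>S* x (n + 1) = x n\<close>, in a weak form that passes to coordinatewise limits.\<close>

definition dilation :: "'h inner_space \<Rightarrow> ('h \<Rightarrow> 'h) \<Rightarrow> (nat \<Rightarrow> 'h) inner_space"
  where "dilation H S =
    \<lparr>carrier = {x. (\<forall>n. x n \<in> carrier H) \<and>
        (\<forall>n. \<forall>h\<in>carrier H. cinner H (x (Suc n)) (S h) = cinner H (x n) h) \<and>
        (\<exists>B. \<forall>n. hnorm H (x n) \<le> B)},
     mult = (\<lambda>x y. x), one = (\<lambda>n. \<zero>\<^bsub>H\<^esub>),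
     zero = (\<lambda>n. \<zero>\<^bsub>H\<^esub>), add = (\<lambda>x y n. x n \<oplus>\<^bsub>H\<^esub> y n),
     smult = (\<lambda>c x n. c \<odot>\<^bsub>H\<^esub> x n),
     cinner = (\<lambda>x y. lim (\<lambda>n. cinner H (x n) (y n)))\<rparr>"

locale hilbert_endo_isometry = H: hilbert_space H + S: hilbert_isometry H H S
  for H :: "'h inner_space" and S
begin

abbreviation "D \<equiv> dilation H S"

lemma dilation_add [simp]: "(x \<oplus>\<^bsub>D\<^esub> y) n = x n \<oplus>\<^bsub>H\<^esub> y n"
  and dilation_smult [simp]: "(c \<odot>\<^bsub>D\<^esub> x) n = c \<odot>\<^bsub>H\<^esub> x n"
  and dilation_zero [simp]: "\<zero>\<^bsub>D\<^esub> n = \<zero>\<^bsub>H\<^esub>"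
  and dilation_cinner: "cinner D x y = lim (\<lambda>n. cinner H (x n) (y n))"
  by (simp_all add: dilation_def)

lemma dilationI:
  assumes "\<And>n. x n \<in> carrier H"
    and "\<And>n h. h \<in> carrier H \<Longrightarrow> cinner H (x (Suc n)) (S h) = cinner H (x n) h"
    and "\<And>n. hnorm H (x n) \<le> B"
  shows "x \<in> carrier D"
  using assms by (auto simp: dilation_def)

lemma dilation_in_H: "x \<in> carrier D \<Longrightarrow> x n \<in> carrier H"
  and dilation_consistent:
    "\<lbrakk>x \<in> carrier D; h \<in> carrier H\<rbrakk> \<Longrightarrow> cinner H (x (Suc n)) (S h) = cinner H (x n) h"
  and dilation_bounded: "x \<in> carrier D \<Longrightarrow> \<exists>B. \<forall>n. hnorm H (x n) \<le> B"
  by (auto simp: dilation_def)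

declare dilation_in_H [simp]

lemma dilation_add_closed:
  assumes x: "x \<in> carrier D" and y: "y \<in> carrier D"
  shows "x \<oplus>\<^bsub>D\<^esub> y \<in> carrier D"
proof -
  obtain B where B: "\<forall>n. hnorm H (x n) \<le> B" using dilation_bounded[OF x] ..
  obtain C where C: "\<forall>n. hnorm H (y n) \<le> C" using dilation_bounded[OF y] ..
  have "hnorm H ((x \<oplus>\<^bsub>D\<^esub> y) n) \<le> B + C" for n
    using H.hnorm_triangle[of "x n" "y n"] x y B[rule_format, of n] C[rule_format, of n] by simp
  then show ?thesis
    using x y by (intro dilationI) (auto simp: H.cinner_add_left dilation_consistent)
qed

lemma dilation_smult_closed:
  assumes x: "x \<in> carrier D"
  shows "c \<odot>\<^bsub>D\<^esub> x \<in> carrier D"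
proof -
  obtain B where "\<forall>n. hnorm H (x n) \<le> B" using dilation_bounded[OF x] ..
  then have "hnorm H ((c \<odot>\<^bsub>D\<^esub> x) n) \<le> cmod c * B" for n
    using x by (simp add: H.hnorm_smult mult_left_mono)
  then show ?thesis
    using x by (intro dilationI)
      (auto simp: H.cinner_smult_left dilation_consistent H.smult_in_carrier)
qed

lemma dilation_zero_closed: "\<zero>\<^bsub>D\<^esub> \<in> carrier D"
proof (rule dilationI)
  have "cinner H \<zero>\<^bsub>H\<^esub> h = 0" if "h \<in> carrier H" for h
    using H.cinner_add_left[of "\<zero>\<^bsub>H\<^esub>" "\<zero>\<^bsub>H\<^esub>" h] that by simp
  then show "cinner H (\<zero>\<^bsub>D\<^esub> (Suc n)) (S h) = cinner H (\<zero>\<^bsub>D\<^esub> n) h" if "h \<in> carrier H" for n h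
    using that by simp
  show "hnorm H (\<zero>\<^bsub>D\<^esub> n) \<le> 0" for n by simp
qed simp

lemma module_dilation: "Module.module complex_field D"
proof (rule moduleI)
  show "abelian_group D"
  proof (rule abelian_groupI)
    fix x assume x: "x \<in> carrier D"
    then have "(-1) \<odot>\<^bsub>D\<^esub> x \<oplus>\<^bsub>D\<^esub> x = \<zero>\<^bsub>D\<^esub>"
      by (intro ext) (simp add: H.smult_minus_one H.M.l_neg)
    then show "\<exists>y\<in>carrier D. y \<oplus>\<^bsub>D\<^esub> x = \<zero>\<^bsub>D\<^esub>"
      using dilation_smult_closed[OF x] by blast
  next
    show "x \<oplus>\<^bsub>D\<^esub> y = y \<oplus>\<^bsub>D\<^esub> x" if "x \<in> carrier D" "y \<in> carrier D" for x y
      using that by (intro ext) (simp add: H.M.a_comm)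
  qed (auto intro!: ext dilation_add_closed dilation_zero_closed simp: H.M.a_assoc)
  show "cring complex_field" by (rule H.R.cring_axioms)
  show "\<And>a x. x \<in> carrier D \<Longrightarrow> a \<odot>\<^bsub>D\<^esub> x \<in> carrier D"
    by (rule dilation_smult_closed)
qed (auto intro!: ext simp: H.smult_l_distr[simplified] H.smult_r_distr[simplified]
      H.smult_assoc1[simplified] H.smult_one[simplified])

text \<open>Coherence tested at h = x n gives |x n|^2 = Re (x (n + 1), S (x n)); apply
  Cauchy-Schwarz and cancel. This is the contractivity of S* in weak form.\<close>

lemma dilation_norm_mono:
  assumes x: "x \<in> carrier D"
  shows "incseq (\<lambda>n. hnorm H (x n))"
proof (rule incseq_SucI)
  fix n
  have "(hnorm H (x n))\<^sup>2 = Re (cinner H (x (Suc n)) (S (x n)))"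
    using x by (simp add: H.hnorm_power2 dilation_consistent)
  also have "\<dots> \<le> hnorm H (x (Suc n)) * hnorm H (x n)"
    using H.Re_Cauchy_Schwarz[of "x (Suc n)" "S (x n)"] x by simp
  finally show "hnorm H (x n) \<le> hnorm H (x (Suc n))"
    using H.hnorm_nonneg[of "x n"] H.hnorm_nonneg[of "x (Suc n)"] x
    by (cases "hnorm H (x n) = 0") (auto simp: power2_eq_square)
qed

lemma dilation_norm_convergent:
  assumes x: "x \<in> carrier D"
  shows "convergent (\<lambda>n. hnorm H (x n))"
proof -
  obtain B where "\<forall>n. hnorm H (x n) \<le> B" using dilation_bounded[OF x] ..
  then show ?thesis
    using incseq_convergent[OF dilation_norm_mono[OF x]] convergentI by (metis (no_types))
qed

text \<open>Written with the pointwise difference because the subtraction of \<open>D\<close> is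
  identified with it only later, in \<open>dilation_minus\<close>.\<close>

lemma dilation_minus_closed:
  assumes "x \<in> carrier D" "y \<in> carrier D"
  shows "(\<lambda>n. x n \<ominus>\<^bsub>H\<^esub> y n) \<in> carrier D"
proof -
  have "(\<lambda>n. x n \<ominus>\<^bsub>H\<^esub> y n) = x \<oplus>\<^bsub>D\<^esub> (-1) \<odot>\<^bsub>D\<^esub> y"
    using assms by (intro ext) (simp add: H.smult_minus_one H.M.minus_eq)
  then show ?thesis using assms by (simp add: dilation_add_closed dilation_smult_closed)
qed

text \<open>Sum and difference of coherent sequences are coherent, so their norms converge;
  polarisation does the rest.\<close>

lemma dilation_Re_convergent:
  assumes x: "x \<in> carrier D" and y: "y \<in> carrier D"
  shows "convergent (\<lambda>n. Re (cinner H (x n) (y n)))"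
proof -
  have "convergent (\<lambda>n. hnorm H (x n \<oplus>\<^bsub>H\<^esub> y n))" "convergent (\<lambda>n. hnorm H (x n \<ominus>\<^bsub>H\<^esub> y n))"
    using dilation_norm_convergent[OF dilation_add_closed[OF x y]]
      dilation_norm_convergent[OF dilation_minus_closed[OF x y]] by simp_all
  then obtain a b where "(\<lambda>n. hnorm H (x n \<oplus>\<^bsub>H\<^esub> y n)) \<longlonglongrightarrow> a" "(\<lambda>n. hnorm H (x n \<ominus>\<^bsub>H\<^esub> y n)) \<longlonglongrightarrow> b"
    by (auto simp: convergent_def)
  then have "(\<lambda>n. ((hnorm H (x n \<oplus>\<^bsub>H\<^esub> y n))\<^sup>2 - (hnorm H (x n \<ominus>\<^bsub>H\<^esub> y n))\<^sup>2) / 4) \<longlonglongrightarrow> (a\<^sup>2 - b\<^sup>2) / 4"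
    by (intro tendsto_intros) auto
  then show ?thesis using x y convergentI by (simp only: H.Re_cinner_polar dilation_in_H)
qed

text \<open>Shows that the \<open>lim\<close> in the definition is a genuine limit, the imaginary
  part being the real part for \<i> y.\<close>

lemma dilation_cinner_lim:
  assumes x: "x \<in> carrier D" and y: "y \<in> carrier D"
  shows "(\<lambda>n. cinner H (x n) (y n)) \<longlonglongrightarrow> cinner D x y"
proof -
  obtain a b where "(\<lambda>n. Re (cinner H (x n) (y n))) \<longlonglongrightarrow> a"
      "(\<lambda>n. Re (cinner H (x n) ((\<i> \<odot>\<^bsub>D\<^esub> y) n))) \<longlonglongrightarrow> b"
    using dilation_Re_convergent[OF x y]
      dilation_Re_convergent[OF x dilation_smult_closed[OF y], of \<i>] unfolding convergent_def by blast
  then have "(\<lambda>n. cinner H (x n) (y n)) \<longlonglongrightarrow> Complex a b"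
    using x y by (simp add: tendsto_complex_iff H.Im_cinner)
  moreover from this have "lim (\<lambda>n. cinner H (x n) (y n)) = Complex a b" by (rule limI)
  ultimately show ?thesis by (simp add: dilation_cinner)
qed

lemma dilation_norm_lim:
  assumes x: "x \<in> carrier D"
  shows "(\<lambda>n. hnorm H (x n)) \<longlonglongrightarrow> hnorm D x"
  unfolding hnorm_def using dilation_cinner_lim[OF x x] by (intro tendsto_intros)

text \<open>The limit of an increasing sequence is its supremum. Together with
  \<open>dilation_norm_leI\<close> this lets the norm of \<open>D\<close> be handled as a supremum
  norm.\<close>

lemma dilation_norm_le:
  assumes x: "x \<in> carrier D"
  shows "hnorm H (x n) \<le> hnorm D x"
  using incseq_le[OF dilation_norm_mono[OF x] dilation_norm_lim[OF x]] by simp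

lemma dilation_cinner_eqI:
  assumes "x \<in> carrier D" "y \<in> carrier D"
    and "(\<lambda>n. cinner H (x n) (y n)) \<longlonglongrightarrow> l"
  shows "cinner D x y = l"
  using LIMSEQ_unique[OF dilation_cinner_lim assms(3)] assms by simp

sublocale D: complex_inner_space D
proof (intro complex_inner_space.intro module_dilation complex_inner_space_axioms.intro)
  fix x y z assume "x \<in> carrier D" "y \<in> carrier D" "z \<in> carrier D"
  then show "cinner D (x \<oplus>\<^bsub>D\<^esub> y) z = cinner D x z + cinner D y z"
    by (intro dilation_cinner_eqI)
      (auto simp: H.cinner_add_left dilation_add_closed intro!: tendsto_add dilation_cinner_lim)
next
  fix c x y assume "x \<in> carrier D" "y \<in> carrier D"
  then show "cinner D (c \<odot>\<^bsub>D\<^esub> x) y = c * cinner D x y"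
    by (intro dilation_cinner_eqI)
      (auto simp: H.cinner_smult_left dilation_smult_closed intro!: tendsto_mult dilation_cinner_lim)
next
  fix x y assume xy: "x \<in> carrier D" "y \<in> carrier D"
  then have "(\<lambda>n. cnj (cinner H (y n) (x n))) \<longlonglongrightarrow> cnj (cinner D y x)"
    by (intro tendsto_cnj dilation_cinner_lim)
  moreover have "cnj (cinner H (y n) (x n)) = cinner H (x n) (y n)" for n
    using H.cinner_commute[of "x n" "y n"] xy by simp
  ultimately have "(\<lambda>n. cinner H (x n) (y n)) \<longlonglongrightarrow> cnj (cinner D y x)" by simp
  then show "cinner D x y = cnj (cinner D y x)" using xy by (rule_tac dilation_cinner_eqI)
next
  fix x assume x: "x \<in> carrier D"
  show "0 \<le> Re (cinner D x x)"
    using tendsto_Re[OF dilation_cinner_lim[OF x x]]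
    by (rule LIMSEQ_le_const) (use x H.cinner_nonneg in auto)
next
  fix x assume x: "x \<in> carrier D" and "cinner D x x = 0"
  then have "hnorm D x = 0" by (simp add: hnorm_def)
  \<comment> \<open>An increasing sequence of nonnegative norms with limit zero vanishes
    identically; this makes the limit form definite.\<close>
  then have "hnorm H (x n) = 0" for n
    using dilation_norm_le[OF x, of n] H.hnorm_nonneg[of "x n"] x by simp
  then show "x = \<zero>\<^bsub>D\<^esub>" using x by (intro ext) (simp add: H.hnorm_eq_zero)
qed

lemma dilation_minus:
  assumes "x \<in> carrier D" "y \<in> carrier D"
  shows "(x \<ominus>\<^bsub>D\<^esub> y) n = x n \<ominus>\<^bsub>H\<^esub> y n"
  using assms D.smult_minus_one[of y, symmetric]
  by (simp add: D.M.minus_eq H.M.minus_eq H.smult_minus_one)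

lemma dilation_norm_leI:
  assumes "x \<in> carrier D" "\<And>n. hnorm H (x n) \<le> b"
  shows "hnorm D x \<le> b"
  using dilation_norm_lim[OF assms(1)] by (rule LIMSEQ_le_const2) (use assms in auto)

text \<open>Completeness as for bounded functions with the supremum norm: coordinatewise limits
  exist, and coherence survives because inner products are continuous.\<close>

sublocale D: hilbert_space D
proof (rule hilbert_spaceI[OF D.complex_inner_space_axioms])
  fix s :: "nat \<Rightarrow> nat \<Rightarrow> 'h"
  assume s: "\<And>i. s i \<in> carrier D"
    and Cauchy: "\<And>e. 0 < e \<Longrightarrow> \<exists>N. \<forall>i\<ge>N. \<forall>j\<ge>N. hnorm D (s i \<ominus>\<^bsub>D\<^esub> s j) < e"
  have coord: "hnorm H (s i n \<ominus>\<^bsub>H\<^esub> s j n) \<le> hnorm D (s i \<ominus>\<^bsub>D\<^esub> s j)" for i j n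
    using dilation_norm_le[of "s i \<ominus>\<^bsub>D\<^esub> s j" n] s by (simp add: dilation_minus)
  have "\<exists>y\<in>carrier H. (\<lambda>i. hnorm H (s i n \<ominus>\<^bsub>H\<^esub> y)) \<longlonglongrightarrow> 0" for n
  proof -
    have "s i n \<in> carrier H" for i using s by simp
    moreover have "\<exists>N. \<forall>i\<ge>N. \<forall>j\<ge>N. hnorm H (s i n \<ominus>\<^bsub>H\<^esub> s j n) < e" if "0 < e" for e
      using Cauchy[OF that] coord by (meson le_less_trans)
    ultimately show ?thesis using H.Cauchy_converges[of "\<lambda>i. s i n"] by blast
  qed
  then obtain x where x: "\<And>n. x n \<in> carrier H"
      and lim: "\<And>n. (\<lambda>i. hnorm H (s i n \<ominus>\<^bsub>H\<^esub> x n)) \<longlonglongrightarrow> 0"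
    by metis
  \<comment> \<open>Let j tend to infinity. The index N does not depend on the coordinate n, so the
    estimate is uniform in n.\<close>
  have near: "hnorm H (s i n \<ominus>\<^bsub>H\<^esub> x n) \<le> e"
    if N: "\<And>j. j \<ge> N \<Longrightarrow> hnorm D (s i \<ominus>\<^bsub>D\<^esub> s j) < e" for i n e N
  proof -
    have "(\<lambda>j. e + hnorm H (s j n \<ominus>\<^bsub>H\<^esub> x n)) \<longlonglongrightarrow> e + 0" by (intro tendsto_intros lim)
    moreover have "hnorm H (s i n \<ominus>\<^bsub>H\<^esub> x n) \<le> e + hnorm H (s j n \<ominus>\<^bsub>H\<^esub> x n)" if "j \<ge> N" for j
      using H.hnorm_diff_triangle[of "s i n" "s j n" "x n"] coord[of i n j] N[OF that] s x by simp
    ultimately show ?thesis using LIMSEQ_le_const by fastforce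
  qed
  have "x \<in> carrier D"
  proof -
    obtain N where N: "\<And>i j. \<lbrakk>i \<ge> N; j \<ge> N\<rbrakk> \<Longrightarrow> hnorm D (s i \<ominus>\<^bsub>D\<^esub> s j) < 1"
      using Cauchy[of 1] by auto
    have "hnorm H (x n) \<le> hnorm D (s N) + 1" for n
      using near[of N N 1 n] N[of N] dilation_norm_le[OF s, of N n]
        H.hnorm_triangle_ineq2[of "s N n" "x n"] s x by fastforce
    moreover have "cinner H (x (Suc n)) (S h) = cinner H (x n) h" if h: "h \<in> carrier H" for n h
    proof -
      have "(\<lambda>i. cinner H (s i (Suc n)) (S h)) \<longlonglongrightarrow> cinner H (x (Suc n)) (S h)"
        using s x h lim by (intro H.cinner_tendsto_left) auto
      moreover have "(\<lambda>i. cinner H (s i n) h) \<longlonglongrightarrow> cinner H (x n) h"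
        using s x h lim by (intro H.cinner_tendsto_left) auto
      ultimately show ?thesis
        using s h by (simp add: dilation_consistent LIMSEQ_unique)
    qed
    ultimately show ?thesis using x by (intro dilationI)
  qed
  moreover have "(\<lambda>i. hnorm D (s i \<ominus>\<^bsub>D\<^esub> x)) \<longlonglongrightarrow> 0"
  proof (rule LIMSEQ_I)
    fix r :: real assume "0 < r"
    then obtain N where N: "\<And>i j. \<lbrakk>i \<ge> N; j \<ge> N\<rbrakk> \<Longrightarrow> hnorm D (s i \<ominus>\<^bsub>D\<^esub> s j) < r / 2"
      using Cauchy[of "r / 2"] by auto
    have "hnorm D (s i \<ominus>\<^bsub>D\<^esub> x) < r" if "i \<ge> N" for i
    proof -
      have "hnorm D (s i \<ominus>\<^bsub>D\<^esub> x) \<le> r / 2"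
      proof (rule dilation_norm_leI)
        show "hnorm H ((s i \<ominus>\<^bsub>D\<^esub> x) n) \<le> r / 2" for n
          using near[of N i "r / 2" n] N[OF that] s \<open>x \<in> carrier D\<close> by (simp add: dilation_minus)
      qed (use s \<open>x \<in> carrier D\<close> in simp)
      then show ?thesis using \<open>0 < r\<close> by simp
    qed
    then show "\<exists>N. \<forall>i\<ge>N. norm (hnorm D (s i \<ominus>\<^bsub>D\<^esub> x) - 0) < r"
      using s \<open>x \<in> carrier D\<close> by (auto simp: D.hnorm_nonneg intro!: exI[of _ N])
  qed
  ultimately show "\<exists>x\<in>carrier D. (\<lambda>i. hnorm D (s i \<ominus>\<^bsub>D\<^esub> x)) \<longlonglongrightarrow> 0" by blast
qed

end

subsection \<open>Representations are contractive\<close>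

lemma norm_star: "norm (star x) = norm (x :: 'g :: cstar_algebra)"
proof -
  have le: "norm y \<le> norm (star y)" for y :: 'g
  proof -
    have "norm y * norm y \<le> norm (star y) * norm y"
      using norm_mult_ineq[of "star y" y] by (simp add: cstar_identity power2_eq_square)
    then show ?thesis by (cases "norm y = 0") simp_all
  qed
  show ?thesis using le[of x] le[of "star x"] by (simp add: star_star)
qed

lemma star_scaleR: "star (scaleR r x) = scaleR r (star x :: 'g :: cstar_algebra)"
  by (simp add: scaleR_scaleC star_scaleC)

text \<open>\<open>1 - b\<close> is the positive square root of \<open>1 - a\<close>, but the algebra need not have a unit.\<close>

lemma selfadjoint_quadratic:
  fixes a :: "'g :: cstar_algebra"
  assumes a: "star a = a" and "norm a < 1"
  obtains b where "star b = b" "b + b - b * b = a"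
proof -
  \<comment> \<open>The equation for b is the fixed point equation b = (a + b * b) / 2. On the ball
    of radius norm a < 1, F maps the ball to itself and contracts by the factor norm a.\<close>
  define F where "F b = (1/2) *\<^sub>R (a + b * b)" for b
  let ?s = "cball (0 :: 'g) (norm a)"
  have norm_F: "F b \<in> ?s" if "b \<in> ?s" for b
  proof -
    have "norm (b * b) \<le> norm a * norm a"
      using that norm_mult_ineq[of b b] mult_mono[of "norm b" "norm a" "norm b" "norm a"] by simp
    also have "\<dots> \<le> norm a * 1" using \<open>norm a < 1\<close> by (intro mult_left_mono) auto
    finally have "norm (a + b * b) \<le> 2 * norm a" using norm_triangle_ineq[of a "b * b"] by simp
    then show ?thesis by (simp add: F_def)
  qed
  have lip: "dist (F b) (F c) \<le> norm a * dist b c" if b: "b \<in> ?s" and c: "c \<in> ?s" for b c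
  proof -
    \<comment> \<open>The difference of squares is split in a form valid without
      commutativity.\<close>
    have "F b - F c = (1/2) *\<^sub>R (b * (b - c) + (b - c) * c)"
      by (simp add: F_def algebra_simps flip: scaleR_diff_right)
    moreover have "norm (b * (b - c)) \<le> norm a * norm (b - c)"
      using b norm_mult_ineq[of b "b - c"] mult_right_mono[of "norm b" "norm a" "norm (b - c)"] by simp
    moreover have "norm ((b - c) * c) \<le> norm a * norm (b - c)"
      using c norm_mult_ineq[of "b - c" c] mult_left_mono[of "norm c" "norm a" "norm (b - c)"]
      by (simp add: mult.commute)
    ultimately show ?thesis
      using norm_triangle_ineq[of "b * (b - c)" "(b - c) * c"] by (simp add: dist_norm)
  qed
  have "\<exists>!b. b \<in> ?s \<and> F b = b"
    using norm_F lip \<open>norm a < 1\<close>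
    by (intro Banach_fix[of _ "norm a"]) (auto simp: complete_eq_closed)
  then obtain b where b: "b \<in> ?s" "F b = b" and uniq: "\<And>c. c \<in> ?s \<Longrightarrow> F c = c \<Longrightarrow> c = b"
    by blast
  \<comment> \<open>So \<open>star b\<close> is a fixed point too, in the same ball; uniqueness
    makes b selfadjoint.\<close>
  have "F (star b) = star (F b)" by (simp add: F_def star_scaleR star_add star_mult a)
  then have "star b = b" using b by (intro uniq) (auto simp: norm_star)
  moreover have "b + b - b * b = a"
  proof -
    have "b + b = 2 *\<^sub>R F b" using b(2) by (simp add: scaleR_2)
    also have "\<dots> = a + b * b" by (simp add: F_def)
    finally show ?thesis by simp
  qed
  ultimately show ?thesis by (rule that)
qed

lemma star_representationD:
  assumes "star_representation V \<pi>"
  shows "bounded_op V (\<pi> g)" "linear_op V V (\<pi> g)" "x \<in> carrier V \<Longrightarrow> \<pi> g x \<in> carrier V"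
    "x \<in> carrier V \<Longrightarrow> \<pi> (f + g) x = \<pi> f x \<oplus>\<^bsub>V\<^esub> \<pi> g x"
    "x \<in> carrier V \<Longrightarrow> \<pi> (scaleC c g) x = c \<odot>\<^bsub>V\<^esub> \<pi> g x"
    "x \<in> carrier V \<Longrightarrow> \<pi> (f * g) x = \<pi> f (\<pi> g x)"
    "\<lbrakk>x \<in> carrier V; y \<in> carrier V\<rbrakk> \<Longrightarrow> cinner V (\<pi> (star g) x) y = cinner V x (\<pi> g y)"
  using assms by (auto simp: star_representation_def bounded_op_def linear_op_def)

text \<open>The estimate \<open>sa\<close> for selfadjoint elements is applied to star g * g, scaled
  to have norm below 1; then the scale s tends to norm g. The constant depends on g alone, so it is
  the same for every representation.\<close>

lemma star_representation_contractive:
  fixes \<pi> :: "'g :: cstar_algebra \<Rightarrow> 'v \<Rightarrow> 'v"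
  assumes "complex_inner_space V" and \<pi>: "star_representation V \<pi>" and x: "x \<in> carrier V"
  shows "hnorm V (\<pi> g x) \<le> norm g * hnorm V x"
proof -
  interpret complex_inner_space V by fact
  note \<pi>D = star_representationD[OF \<pi>]
  \<comment> \<open>With b from \<open>selfadjoint_quadratic\<close>, |\<pi> b x - x|^2 = |x|^2 - Re
    (\<pi> a x, x), and the left side is nonnegative. The unit is supplied by the identity operator
    on V.\<close>
  have sa: "Re (cinner V (\<pi> a x) x) \<le> (hnorm V x)\<^sup>2" if a: "star a = a" "norm a < 1" for a
  proof -
    from a obtain b where b: "star b = b" "b + b - b * b = a" by (rule selfadjoint_quadratic)
    have "b + b = a + b * b" using b(2) by (simp add: algebra_simps)
    then have "\<pi> b x \<oplus>\<^bsub>V\<^esub> \<pi> b x = \<pi> a x \<oplus>\<^bsub>V\<^esub> \<pi> b (\<pi> b x)"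
      using \<pi>D(4)[OF x, of b b] \<pi>D(4)[OF x, of a "b * b"] \<pi>D(6)[OF x, of b b] by simp
    then have "cinner V (\<pi> b x \<oplus>\<^bsub>V\<^esub> \<pi> b x) x = cinner V (\<pi> a x \<oplus>\<^bsub>V\<^esub> \<pi> b (\<pi> b x)) x" by simp
    then have "2 * cinner V (\<pi> b x) x = cinner V (\<pi> a x) x + cinner V (\<pi> b (\<pi> b x)) x"
      using x \<pi>D(3) by (simp add: cinner_add_left)
    also have "cinner V (\<pi> b (\<pi> b x)) x = cinner V (\<pi> b x) (\<pi> b x)"
      using \<pi>D(7)[of "\<pi> b x" x b] \<pi>D(3) x b(1) by simp
    finally have "2 * Re (cinner V (\<pi> b x) x) = Re (cinner V (\<pi> a x) x) + (hnorm V (\<pi> b x))\<^sup>2"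
      using x \<pi>D(3) by (simp add: hnorm_power2 complex_eq_iff)
    then show ?thesis
      using hnorm_diff_power2[of "\<pi> b x" x] x \<pi>D(3) zero_le_power2[of "hnorm V (\<pi> b x \<ominus>\<^bsub>V\<^esub> x)"]
      by simp
  qed
  have bound: "hnorm V (\<pi> g x) \<le> s * hnorm V x" if "norm g < s" for s
  proof -
    have s: "0 < s" using that norm_ge_zero[of g] by linarith
    \<comment> \<open>Chosen so that (\<pi> a x, x) = |\<pi> g x|^2 / s^2, while norm a = (norm g /
      s)^2 is strictly below 1.\<close>
    define a where "a = scaleC (complex_of_real (1 / s\<^sup>2)) (star g * g)"
    have "norm a = (norm g)\<^sup>2 / s\<^sup>2"
      by (simp add: a_def norm_scaleC cstar_identity norm_divide norm_power)
    also have "\<dots> < 1" using that s by (simp add: power_strict_mono)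
    finally have "norm a < 1" .
    moreover have "star a = a" by (simp add: a_def star_scaleC star_mult star_star)
    ultimately have "Re (cinner V (\<pi> a x) x) \<le> (hnorm V x)\<^sup>2" by (intro sa)
    moreover have "cinner V (\<pi> a x) x = complex_of_real (1 / s\<^sup>2) * cinner V (\<pi> g x) (\<pi> g x)"
      using x \<pi>D(3,5,6,7) by (simp add: a_def cinner_smult_left)
    ultimately have "(hnorm V (\<pi> g x))\<^sup>2 / s\<^sup>2 \<le> (hnorm V x)\<^sup>2"
      using x \<pi>D(3) by (simp add: hnorm_power2 flip: of_real_power of_real_divide)
    then have "(hnorm V (\<pi> g x))\<^sup>2 \<le> (s * hnorm V x)\<^sup>2"
      using s by (simp add: field_simps power_mult_distrib)
    then show ?thesis
      using s x hnorm_nonneg by (simp add: power2_le_iff_abs_le)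
  qed
  show ?thesis
  proof (cases "hnorm V x = 0")
    case True
    then show ?thesis using bound[of "norm g + 1"] by simp
  next
    case False
    then have pos: "0 < hnorm V x" using hnorm_nonneg[OF x] by simp
    have "hnorm V (\<pi> g x) / hnorm V x \<le> norm g"
    proof (rule dense_ge)
      fix s assume "norm g < s"
      from bound[OF this] show "hnorm V (\<pi> g x) / hnorm V x \<le> s"
        using pos by (simp add: divide_le_eq)
    qed
    then show ?thesis using pos by (simp add: divide_le_eq)
  qed
qed

subsection \<open>Unitary operators\<close>

lemma isometry_op_comp:
  assumes "isometry_op V1 V2 A" "isometry_op V2 V3 B"
  shows "isometry_op V1 V3 (\<lambda>x. B (A x))"
proof -
  note A = linear_opD[OF isometry_opD(1)[OF assms(1)]] isometry_opD(2)[OF assms(1)]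
  note B = linear_opD[OF isometry_opD(1)[OF assms(2)]] isometry_opD(2)[OF assms(2)]
  show ?thesis by (auto simp: isometry_op_def linear_op_def A B)
qed

lemma isometry_op_funpow:
  assumes "isometry_op V V T" shows "isometry_op V V (T ^^ n)"
proof (induction n)
  case 0
  show ?case by (simp add: isometry_op_def linear_op_def)
next
  case (Suc n)
  from isometry_op_comp[OF this assms] show ?case by (simp add: comp_def)
qed

lemma unitary_op_comp:
  assumes "unitary_op V1 V2 A" "unitary_op V2 V3 B"
  shows "unitary_op V1 V3 (\<lambda>x. B (A x))"
  using assms isometry_op_comp[of V1 V2 A V3 B]
  unfolding unitary_op_def by (metis image_image)

locale unitary_between = isometry_between V W U
  for V :: "'v inner_space" and W :: "'w inner_space" and U +
  assumes surj: "U ` carrier V = carrier W"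
begin

abbreviation "Uinv \<equiv> inv_into (carrier V) U"

lemma inv_closed [simp]: "y \<in> carrier W \<Longrightarrow> Uinv y \<in> carrier V"
  by (simp add: inv_into_into surj)

lemma U_inv [simp]: "y \<in> carrier W \<Longrightarrow> U (Uinv y) = y"
  by (simp add: f_inv_into_f surj)

lemma inv_U [simp]: "x \<in> carrier V \<Longrightarrow> Uinv (U x) = x"
  by (simp add: T_inj)

lemma unitary_inv: "unitary_op W V Uinv"
proof -
  have eqI: "Uinv y = x" if "x \<in> carrier V" "U x = y" for x y
    using that by auto
  have "hnorm V (Uinv y) = hnorm W y" if "y \<in> carrier W" for y
    using that T_norm[of "Uinv y"] by simp
  moreover have "Uinv ` carrier W = carrier V"
  proof
    show "carrier V \<subseteq> Uinv ` carrier W" by (metis T_closed inv_U image_eqI subsetI)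
  qed auto
  ultimately show ?thesis
    unfolding unitary_op_def isometry_op_def linear_op_def
    by (auto intro!: eqI simp: T_add T_smult V.smult_in_carrier)
qed

end

subsection \<open>The dilation is a minimal unitary extension\<close>

lemma shift_funpow: "((\<lambda>x n. x (Suc n)) ^^ m) x n = x (n + m)"
  by (induction m arbitrary: n) auto

context hilbert_endo_isometry
begin

abbreviation "shift \<equiv> \<lambda>(x :: nat \<Rightarrow> 'h) n. x (Suc n)"
abbreviation "emb \<equiv> \<lambda>h n. (S ^^ n) h"

lemma isometry_funpow: "isometry_between H H (S ^^ n)"
  by (intro isometry_between.intro isometry_between_axioms.intro isometry_op_funpow
      H.complex_inner_space_axioms S.isometry)

lemmas funpow_closed [simp] = isometry_between.T_closed[OF isometry_funpow]
lemmas funpow_norm [simp] = isometry_between.T_norm[OF isometry_funpow]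

lemma embed_in_dilation: "h \<in> carrier H \<Longrightarrow> emb h \<in> carrier D"
  by (rule dilationI[where B = "hnorm H h"]) (simp_all add: S.T_cinner)

lemma isometry_embed: "isometry_op H D emb"
proof -
  have "hnorm D (emb h) = hnorm H h" if "h \<in> carrier H" for h
    using LIMSEQ_unique[OF dilation_norm_lim[OF embed_in_dilation[OF that]]] that by simp
  then show ?thesis
    unfolding isometry_op_def linear_op_def
    by (auto simp: embed_in_dilation fun_eq_iff isometry_between.T_add[OF isometry_funpow]
        isometry_between.T_smult[OF isometry_funpow])
qed

sublocale E: hilbert_isometry H D emb
  by unfold_locales (rule isometry_embed)

lemma shift_closed:
  assumes x: "x \<in> carrier D" shows "shift x \<in> carrier D"
proof -
  obtain B where "\<forall>n. hnorm H (x n) \<le> B" using dilation_bounded[OF x] ..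
  then show ?thesis using x by (intro dilationI) (auto simp: dilation_consistent)
qed

text \<open>The norm is a limit, so dropping the first coordinate preserves it. A preimage of x is
  obtained by prepending S* (x 0), the entry forced by coherence.\<close>

lemma unitary_shift: "unitary_op D D shift"
proof -
  have "hnorm D (shift x) = hnorm D x" if x: "x \<in> carrier D" for x
    using LIMSEQ_unique[OF dilation_norm_lim[OF shift_closed[OF x]]
        LIMSEQ_Suc[OF dilation_norm_lim[OF x]]] .
  moreover have "x \<in> shift ` carrier D" if x: "x \<in> carrier D" for x
  proof
    show "x = shift (case_nat (S.adjoint (x 0)) x)" by simp
    show "case_nat (S.adjoint (x 0)) x \<in> carrier D"
    proof (rule dilationI)
      show "case_nat (S.adjoint (x 0)) x n \<in> carrier H" for n
        using x by (cases n) auto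
      show "cinner H (case_nat (S.adjoint (x 0)) x (Suc n)) (S h)
          = cinner H (case_nat (S.adjoint (x 0)) x n) h" if "h \<in> carrier H" for n h
        using x that by (cases n) (auto simp: S.cinner_adj dilation_consistent)
      show "hnorm H (case_nat (S.adjoint (x 0)) x n) \<le> hnorm D x" for n
      proof (cases n)
        case 0
        then show ?thesis
          using S.hnorm_adj_le[of "x 0"] dilation_norm_le[OF x, of 0] x by simp
      qed (use dilation_norm_le[OF x] in simp)
    qed
  qed
  ultimately show ?thesis
    unfolding unitary_op_def isometry_op_def linear_op_def
    by (auto simp: shift_closed fun_eq_iff)
qed

sublocale sh: unitary_between D D shift
  using unitary_shift by unfold_locales (auto simp: unitary_op_def)

section \<open>Density of the backward shifts of H in the dilation\<close>

lemma dilation_cinner_funpow: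
  assumes "x \<in> carrier D" "h \<in> carrier H"
  shows "cinner H (x (p + n)) ((S ^^ p) h) = cinner H (x n) h"
  using assms by (induction p) (auto simp: dilation_consistent)

text \<open>Pythagoras: coherence makes S^p (x n) the orthogonal projection of x (p + n) onto the
  range of S^p.\<close>

lemma dilation_tail_norm:
  assumes x: "x \<in> carrier D"
  shows "(hnorm H (x (p + n) \<ominus>\<^bsub>H\<^esub> (S ^^ p) (x n)))\<^sup>2 = (hnorm H (x (p + n)))\<^sup>2 - (hnorm H (x n))\<^sup>2"
  using x by (simp add: H.hnorm_diff_power2 dilation_cinner_funpow flip: H.hnorm_power2)

text \<open>By \<open>dilation_tail_norm\<close>, every coordinate of the difference has squared
  norm at most |x|^2 - |x N|^2, which is small for large N.\<close>

lemma dilation_approx: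
  assumes x: "x \<in> carrier D" and "0 < e"
  shows "\<exists>N. hnorm D ((shift ^^ N) x \<ominus>\<^bsub>D\<^esub> emb (x N)) < e"
proof -
  have "(\<lambda>n. (hnorm H (x n))\<^sup>2) \<longlonglongrightarrow> (hnorm D x)\<^sup>2"
    by (intro tendsto_intros dilation_norm_lim x)
  \<comment> \<open>A supremum of coordinates yields only a weak inequality; e/2 leaves room for the
    strict one.\<close>
  moreover have "(hnorm D x)\<^sup>2 - (e/2)\<^sup>2 < (hnorm D x)\<^sup>2" using \<open>0 < e\<close> by simp
  ultimately obtain N where N: "(hnorm D x)\<^sup>2 - (e/2)\<^sup>2 < (hnorm H (x N))\<^sup>2"
    using order_tendstoD(1) eventually_happens'[OF sequentially_bot] by blast
  have shN: "(shift ^^ N) x \<in> carrier D"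
    by (induction N) (auto simp: x shift_closed)
  have "hnorm D ((shift ^^ N) x \<ominus>\<^bsub>D\<^esub> emb (x N)) \<le> e / 2"
  proof (rule dilation_norm_leI)
    fix n
    have "(hnorm H (x (n + N)))\<^sup>2 \<le> (hnorm D x)\<^sup>2"
      using dilation_norm_le[OF x] H.hnorm_nonneg x by (intro power_mono) auto
    then have "(hnorm H (x (n + N) \<ominus>\<^bsub>H\<^esub> (S ^^ n) (x N)))\<^sup>2 \<le> (e/2)\<^sup>2"
      using N dilation_tail_norm[OF x, of n N] by simp
    then have "hnorm H (x (n + N) \<ominus>\<^bsub>H\<^esub> (S ^^ n) (x N)) \<le> e/2"
      by (rule power2_le_imp_le) (use \<open>0 < e\<close> in simp)
    then show "hnorm H (((shift ^^ N) x \<ominus>\<^bsub>D\<^esub> emb (x N)) n) \<le> e / 2"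
      using dilation_minus[OF shN embed_in_dilation[OF dilation_in_H[OF x]]]
      by (simp add: shift_funpow)
  qed (intro D.M.minus_closed shN embed_in_dilation dilation_in_H x)
  then show ?thesis using \<open>0 < e\<close> by (intro exI[of _ N]) simp
qed

end

lemma funpow_inv_into:
  assumes "unitary_between V V U" and y: "y \<in> carrier V"
  defines "I \<equiv> inv_into (carrier V) U"
  shows "(U ^^ n) ((I ^^ n) y) = y \<and> (I ^^ n) y \<in> carrier V"
proof -
  interpret unitary_between V V U by fact
  show ?thesis
  proof (induction n)
    case (Suc n)
    have "(U ^^ Suc n) ((I ^^ Suc n) y) = (U ^^ n) (U (I ((I ^^ n) y)))"
      by (simp add: funpow_swap1)
    then show ?case using Suc by (simp add: I_def)
  qed (use y in simp)
qed

text \<open>Applying \<open>U^n\<close>, the density of the subspaces \<open>U^-n H\<close> turns into a statement without inverses.\<close>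

lemma minimal_density_iff:
  assumes "complex_inner_space K" "unitary_op K K U" "isometry_op H K J"
  shows "htopology K closure_of (\<Union>n. (inv_into (carrier K) U ^^ n) ` J ` carrier H) = carrier K
    \<longleftrightarrow> (\<forall>y\<in>carrier K. \<forall>e>0. \<exists>n. \<exists>h\<in>carrier H. hnorm K ((U ^^ n) y \<ominus>\<^bsub>K\<^esub> J h) < e)"
proof -
  interpret K: complex_inner_space K by fact
  interpret U: unitary_between K K U
    using assms by unfold_locales (auto simp: unitary_op_def)
  note J = linear_opD[OF isometry_opD(1)[OF assms(3)]]
  have dist: "hnorm K (y \<ominus>\<^bsub>K\<^esub> (U.Uinv ^^ n) (J h)) = hnorm K ((U ^^ n) y \<ominus>\<^bsub>K\<^esub> J h)"
    if y: "y \<in> carrier K" and h: "h \<in> carrier H" for y n h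
  proof -
    interpret Un: isometry_between K K "U ^^ n"
      by unfold_locales (rule isometry_op_funpow[OF U.isometry])
    show ?thesis
      using Un.T_norm[of "y \<ominus>\<^bsub>K\<^esub> (U.Uinv ^^ n) (J h)"] y
        funpow_inv_into[OF U.unitary_between_axioms J(1)[OF h], of n]
      by (simp add: Un.T_diff)
  qed
  have "htopology K closure_of (\<Union>n. (U.Uinv ^^ n) ` J ` carrier H) = {y \<in> carrier K.
      \<forall>e>0. \<exists>n. \<exists>h\<in>carrier H. hnorm K ((U ^^ n) y \<ominus>\<^bsub>K\<^esub> J h) < e}"
  proof -
    have "(\<Union>n. (U.Uinv ^^ n) ` J ` carrier H) \<inter> carrier K = (\<Union>n. (U.Uinv ^^ n) ` J ` carrier H)"
      using funpow_inv_into[OF U.unitary_between_axioms J(1)] by auto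
    moreover have "(\<exists>z\<in>(\<Union>n. (U.Uinv ^^ n) ` J ` carrier H). hnorm K (y \<ominus>\<^bsub>K\<^esub> z) < e)
        \<longleftrightarrow> (\<exists>n. \<exists>h\<in>carrier H. hnorm K ((U ^^ n) y \<ominus>\<^bsub>K\<^esub> J h) < e)"
      if "y \<in> carrier K" for y e
      by (simp add: dist[OF that] cong: bex_cong)
    ultimately show ?thesis unfolding K.htopology_closure_eq by auto
  qed
  then show ?thesis by auto
qed

lemma (in hilbert_endo_isometry) minimal_unitary_extension_dilation:
  "minimal_unitary_extension H S D emb shift"
proof -
  have "htopology D closure_of (\<Union>n. (sh.Uinv ^^ n) ` emb ` carrier H) = carrier D"
    unfolding minimal_density_iff[OF D.complex_inner_space_axioms unitary_shift isometry_embed]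
  proof (intro ballI allI impI)
    fix y e assume y: "y \<in> carrier D" and "0 < (e :: real)"
    then obtain N where "hnorm D ((shift ^^ N) y \<ominus>\<^bsub>D\<^esub> emb (y N)) < e"
      using dilation_approx by blast
    with dilation_in_H[OF y]
    show "\<exists>n. \<exists>h\<in>carrier H. hnorm D ((shift ^^ n) y \<ominus>\<^bsub>D\<^esub> emb h) < e" by blast
  qed
  then show ?thesis
    unfolding minimal_unitary_extension_def contains_via_def
    using E.closedin_range D.hilbert_space_axioms isometry_embed unitary_shift
    by (auto simp: funpow_swap1)
qed

lemma linear_op_comp:
  assumes "linear_op V1 V2 A" "linear_op V2 V3 B"
  shows "linear_op V1 V3 (\<lambda>x. B (A x))"
  using linear_opD[OF assms(1)] linear_opD[OF assms(2)] by (auto simp: linear_op_def)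

subsection \<open>Every minimal unitary extension is isomorphic to the dilation\<close>

locale minimal_extension = hilbert_endo_isometry H S
  for H :: "'h inner_space" and S +
  fixes K :: "'k inner_space" and J U
  assumes minimal: "minimal_unitary_extension H S K J U"
begin

sublocale K: hilbert_space K
  using minimal by (simp add: minimal_unitary_extension_def)

sublocale J: hilbert_isometry H K J
  using minimal by unfold_locales (simp add: minimal_unitary_extension_def contains_via_def)

sublocale U: unitary_between K K U
  using minimal by unfold_locales (auto simp: minimal_unitary_extension_def unitary_op_def)

lemma U_J: "h \<in> carrier H \<Longrightarrow> U (J h) = J (S h)"
  using minimal by (simp add: minimal_unitary_extension_def)

lemma isometry_funpow_U: "isometry_between K K (U ^^ n)"
  by (intro isometry_between.intro isometry_between_axioms.intro isometry_op_funpow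
      K.complex_inner_space_axioms U.isometry)

lemmas Un_closed [simp] = isometry_between.T_closed[OF isometry_funpow_U]
lemmas Un_norm [simp] = isometry_between.T_norm[OF isometry_funpow_U]
lemmas Un_add = isometry_between.T_add[OF isometry_funpow_U]
lemmas Un_smult = isometry_between.T_smult[OF isometry_funpow_U]
lemmas Un_diff = isometry_between.T_diff[OF isometry_funpow_U]

lemma Un_J: "h \<in> carrier H \<Longrightarrow> (U ^^ n) (J h) = J ((S ^^ n) h)"
  by (induction n) (simp_all add: U_J)

lemma dense:
  assumes "y \<in> carrier K" "0 < e"
  obtains n h where "h \<in> carrier H" "hnorm K ((U ^^ n) y \<ominus>\<^bsub>K\<^esub> J h) < e"
proof -
  have "htopology K closure_of (\<Union>n. (U.Uinv ^^ n) ` J ` carrier H) = carrier K"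
    using minimal by (simp add: minimal_unitary_extension_def)
  moreover have "unitary_op K K U"
    using U.isometry U.surj by (simp add: unitary_op_def)
  ultimately show ?thesis
    using minimal_density_iff[OF K.complex_inner_space_axioms _ J.isometry] assms that by blast
qed

definition \<Phi> :: "'k \<Rightarrow> nat \<Rightarrow> 'h" where "\<Phi> y n = J.adjoint ((U ^^ n) y)"

text \<open>Coherence holds because U J = J S and U preserves inner products: one factor U cancels
  on both sides.\<close>

lemma \<Phi>_closed:
  assumes y: "y \<in> carrier K" shows "\<Phi> y \<in> carrier D"
proof (rule dilationI)
  show "\<Phi> y n \<in> carrier H" for n using y by (simp add: \<Phi>_def)
  show "hnorm H (\<Phi> y n) \<le> hnorm K y" for n
    using J.hnorm_adj_le[of "(U ^^ n) y"] y by (simp add: \<Phi>_def)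
  show "cinner H (\<Phi> y (Suc n)) (S h) = cinner H (\<Phi> y n) h" if h: "h \<in> carrier H" for n h
  proof -
    have "cinner H (\<Phi> y (Suc n)) (S h) = cinner K (U ((U ^^ n) y)) (U (J h))"
      using y h U.T_closed[OF Un_closed[OF y]] by (simp add: \<Phi>_def J.cinner_adj U_J)
    also have "\<dots> = cinner H (\<Phi> y n) h"
      using y h by (simp add: \<Phi>_def J.cinner_adj U.T_cinner)
    finally show ?thesis .
  qed
qed

text \<open>The inequality from below uses minimality: if U^n y is within e/2 of J h, then h is
  within e/2 of \<open>\<Phi> y n\<close>, as J* is a contraction with J* J = 1, and |h| is within
  e/2 of |y|.\<close>

lemma \<Phi>_norm:
  assumes y: "y \<in> carrier K" shows "hnorm D (\<Phi> y) = hnorm K y"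
proof (rule antisym)
  show "hnorm D (\<Phi> y) \<le> hnorm K y"
  proof (rule dilation_norm_leI[OF \<Phi>_closed[OF y]])
    show "hnorm H (\<Phi> y n) \<le> hnorm K y" for n
      using J.hnorm_adj_le[of "(U ^^ n) y"] y by (simp add: \<Phi>_def)
  qed
  show "hnorm K y \<le> hnorm D (\<Phi> y)"
  proof (rule field_le_epsilon)
    fix e :: real assume "0 < e"
    then obtain n h where h: "h \<in> carrier H" and e: "hnorm K ((U ^^ n) y \<ominus>\<^bsub>K\<^esub> J h) < e / 2"
      using dense[OF y half_gt_zero] by blast
    have \<Phi>n: "\<Phi> y n \<in> carrier H" using \<Phi>_closed[OF y] by (rule dilation_in_H)
    have "\<Phi> y n \<ominus>\<^bsub>H\<^esub> h = J.adjoint ((U ^^ n) y \<ominus>\<^bsub>K\<^esub> J h)"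
      using linear_op_diff[OF K.complex_inner_space_axioms H.complex_inner_space_axioms J.linear_adj] y h
      by (simp add: \<Phi>_def J.adj_apply)
    then have "hnorm H (\<Phi> y n \<ominus>\<^bsub>H\<^esub> h) < e / 2"
      using J.hnorm_adj_le[of "(U ^^ n) y \<ominus>\<^bsub>K\<^esub> J h"] e y h by simp
    then have "hnorm H h \<le> hnorm H (\<Phi> y n) + e / 2"
      using H.hnorm_triangle_ineq2[OF \<Phi>n h] by simp
    moreover have "hnorm K y \<le> hnorm H h + e / 2"
      using K.hnorm_triangle_ineq2[of "(U ^^ n) y" "J h"] e y h by simp
    ultimately show "hnorm K y \<le> hnorm D (\<Phi> y) + e"
      using dilation_norm_le[OF \<Phi>_closed[OF y], of n] by simp
  qed
qed

lemma \<Phi>_isometry: "isometry_op K D \<Phi>"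
proof -
  note adj = linear_opD[OF J.linear_adj]
  show ?thesis
    unfolding isometry_op_def linear_op_def
    by (auto simp: \<Phi>_closed \<Phi>_norm fun_eq_iff \<Phi>_def[of _ "_ :: nat"] Un_add Un_smult adj)
qed

lemma \<Phi>_J: "h \<in> carrier H \<Longrightarrow> \<Phi> (J h) = emb h"
  by (rule ext) (simp add: \<Phi>_def Un_J J.adj_apply)

lemma \<Phi>_U: "\<Phi> (U y) = shift (\<Phi> y)"
  by (rule ext) (simp add: \<Phi>_def funpow_swap1)

sublocale \<Phi>: hilbert_isometry K D \<Phi>
  by unfold_locales (rule \<Phi>_isometry)

text \<open>The range is closed and contains the backward shifts of H, which are the images of the
  U^-n J h; these are dense because the dilation is itself minimal.\<close>

lemma \<Phi>_surj: "\<Phi> ` carrier K = carrier D"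
proof
  have "(\<Union>n. (sh.Uinv ^^ n) ` emb ` carrier H) \<subseteq> \<Phi> ` carrier K"
  proof clarify
    fix n h assume h: "h \<in> carrier H"
    interpret shn: isometry_between D D "shift ^^ n"
      by unfold_locales (rule isometry_op_funpow[OF sh.isometry])
    define z where "z = (U.Uinv ^^ n) (J h)"
    have z: "z \<in> carrier K" "(U ^^ n) z = J h"
      using funpow_inv_into[OF U.unitary_between_axioms J.T_closed[OF h]] by (auto simp: z_def)
    have "\<Phi> ((U ^^ n) y) = (shift ^^ n) (\<Phi> y)" for y
      by (induction n) (simp_all add: \<Phi>_U)
    from this[of z] have "(shift ^^ n) (\<Phi> z) = emb h" unfolding z(2) \<Phi>_J[OF h] by (rule sym)
    moreover have "(shift ^^ n) ((sh.Uinv ^^ n) (emb h)) = emb h \<and> (sh.Uinv ^^ n) (emb h) \<in> carrier D"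
      using funpow_inv_into[OF sh.unitary_between_axioms embed_in_dilation[OF h]] by auto
    ultimately have "\<Phi> z = (sh.Uinv ^^ n) (emb h)"
      using shn.T_inj \<Phi>_closed[OF z(1)] by (metis inj_onD)
    then show "(sh.Uinv ^^ n) (emb h) \<in> \<Phi> ` carrier K" using z(1) by (metis imageI)
  qed
  from closure_of_minimal[OF this \<Phi>.closedin_range] show "carrier D \<subseteq> \<Phi> ` carrier K"
    using minimal_unitary_extension_dilation by (simp add: minimal_unitary_extension_def)
qed (auto simp: \<Phi>_closed)

sublocale \<Phi>: unitary_between K D \<Phi>
  by unfold_locales (rule \<Phi>_surj)

lemma unitary_\<Phi>: "unitary_op K D \<Phi>"
  using \<Phi>_isometry \<Phi>_surj by (simp add: unitary_op_def)

end

text \<open>Both extensions are unitarily equivalent to the dilation, so W is one equivalence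
  followed by the inverse of the other; its identities are checked after applying
  \<open>E2.\<Phi>\<close>.\<close>

lemma minimal_unitary_extension_unique:
  assumes "minimal_extension H S K1 J1 U1" "minimal_extension H S K2 J2 U2"
  shows "\<exists>W. unitary_op K1 K2 W \<and> (\<forall>x\<in>carrier H. W (J1 x) = J2 x) \<and>
    (\<forall>y\<in>carrier K1. W (U1 y) = U2 (W y))"
proof -
  interpret E1: minimal_extension H S K1 J1 U1 by fact
  interpret E2: minimal_extension H S K2 J2 U2 by fact
  define W where "W y = E2.\<Phi>.Uinv (E1.\<Phi> y)" for y
  have W_eqI: "W y = z" if "z \<in> carrier K2" "E2.\<Phi> z = E1.\<Phi> y" for y z
    unfolding W_def using that by (metis E2.\<Phi>.inv_U)
  have W: "unitary_op K1 K2 W"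
    unfolding W_def by (rule unitary_op_comp[OF E1.unitary_\<Phi> E2.\<Phi>.unitary_inv])
  moreover have "W (J1 x) = J2 x" if "x \<in> carrier H" for x
    using that by (intro W_eqI) (simp_all add: E1.\<Phi>_J E2.\<Phi>_J)
  moreover have "W (U1 y) = U2 (W y)" if y: "y \<in> carrier K1" for y
  proof (rule W_eqI)
    have "E1.\<Phi> y \<in> carrier E1.D" using y by (rule E1.\<Phi>_closed)
    then show "U2 (W y) \<in> carrier K2" "E2.\<Phi> (U2 (W y)) = E1.\<Phi> (U1 y)"
      by (simp_all add: W_def E1.\<Phi>_U E2.\<Phi>_U)
  qed
  ultimately show ?thesis by blast
qed

subsection \<open>Lifting representations\<close>

lemma star_endomorphism_funpow:
  assumes "star_endomorphism \<alpha>" shows "star_endomorphism (\<alpha> ^^ n)"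
  using assms by (induction n) (auto simp: star_endomorphism_def)

text \<open>Used with \<alpha>^n: contractivity of the composite bounds \<pi> (\<alpha>^n g) by norm
  g, uniformly in n.\<close>

lemma star_representation_endomorphism:
  assumes "star_endomorphism \<alpha>" "star_representation V \<pi>"
  shows "star_representation V (\<lambda>g. \<pi> (\<alpha> g))"
  using assms by (simp add: star_endomorphism_def star_representation_def flip: star_mult)

lemma star_representation_adjoint:
  fixes \<pi> :: "'g::cstar_algebra \<Rightarrow> 'v \<Rightarrow> 'v"
  assumes "star_representation V \<pi>" "x \<in> carrier V" "y \<in> carrier V"
  shows "cinner V (\<pi> g x) y = cinner V x (\<pi> (star g) y)"
  using star_representationD(7)[OF assms, of "star g"] by (simp add: star_star)

locale covariant_representation = hilbert_endo_isometry H S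
  for H :: "'h inner_space" and S +
  fixes \<alpha> :: "'g::cstar_algebra \<Rightarrow> 'g" and \<pi> :: "'g \<Rightarrow> 'h \<Rightarrow> 'h"
  assumes endo: "star_endomorphism \<alpha>"
    and rep: "star_representation H \<pi>"
    and cov: "covariant H S \<alpha> \<pi>"
begin

lemmas rep_n = star_representation_endomorphism[OF star_endomorphism_funpow[OF endo] rep]
lemmas \<pi>D = star_representationD[OF rep]

lemma \<alpha>n_simps [simp]:
  "(\<alpha> ^^ n) (f + g) = (\<alpha> ^^ n) f + (\<alpha> ^^ n) g" "(\<alpha> ^^ n) (scaleC c g) = scaleC c ((\<alpha> ^^ n) g)"
  "(\<alpha> ^^ n) (f * g) = (\<alpha> ^^ n) f * (\<alpha> ^^ n) g" "(\<alpha> ^^ n) (star g) = star ((\<alpha> ^^ n) g)"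
  using star_endomorphism_funpow[OF endo, of n] by (auto simp: star_endomorphism_def)

lemma contractive_n:
  "x \<in> carrier H \<Longrightarrow> hnorm H (\<pi> ((\<alpha> ^^ n) g) x) \<le> norm g * hnorm H x"
  by (rule star_representation_contractive[OF H.complex_inner_space_axioms rep_n])

definition lift :: "'g \<Rightarrow> (nat \<Rightarrow> 'h) \<Rightarrow> nat \<Rightarrow> 'h"
  where "lift g x n = \<pi> ((\<alpha> ^^ n) g) (x n)"

lemma lift_coord_norm:
  assumes x: "x \<in> carrier D"
  shows "hnorm H (lift g x n) \<le> norm g * hnorm D x"
proof -
  have "hnorm H (lift g x n) \<le> norm g * hnorm H (x n)"
    unfolding lift_def by (rule contractive_n[OF dilation_in_H[OF x]])
  also have "\<dots> \<le> norm g * hnorm D x"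
    by (intro mult_left_mono dilation_norm_le[OF x] norm_ge_zero)
  finally show ?thesis .
qed

text \<open>The adjoint of S \<pi>(star f) = \<pi>(\<alpha>(star f)) S is \<pi>(f) S* = S*
  \<pi>(\<alpha> f). With f = \<alpha>^n g this is the coherence of the new sequence.\<close>

lemma lift_closed:
  assumes x: "x \<in> carrier D" shows "lift g x \<in> carrier D"
proof (rule dilationI[OF _ _ lift_coord_norm[OF x]])
  note xH = dilation_in_H[OF x]
  show "lift g x n \<in> carrier H" for n
    unfolding lift_def by (rule \<pi>D(3)[OF xH])
  fix n h assume h: "h \<in> carrier H"
  have "cinner H (lift g x (Suc n)) (S h) = cinner H (x (Suc n)) (\<pi> (star ((\<alpha> ^^ Suc n) g)) (S h))"
    unfolding lift_def by (rule star_representation_adjoint[OF rep xH S.T_closed[OF h]])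
  also have "star ((\<alpha> ^^ Suc n) g) = \<alpha> ((\<alpha> ^^ n) (star g))"
    using \<alpha>n_simps(4)[of "Suc n" g] by simp
  also have "\<pi> \<dots> (S h) = S (\<pi> ((\<alpha> ^^ n) (star g)) h)"
    using cov h by (simp add: covariant_def)
  also have "cinner H (x (Suc n)) \<dots> = cinner H (x n) (\<pi> (star ((\<alpha> ^^ n) g)) h)"
    using dilation_consistent[OF x \<pi>D(3)[OF h]] by simp
  also have "\<dots> = cinner H (lift g x n) h"
    unfolding lift_def by (rule star_representation_adjoint[OF rep xH h, symmetric])
  finally show "cinner H (lift g x (Suc n)) (S h) = cinner H (lift g x n) h" .
qed

lemma star_representation_lift: "star_representation D lift"
proof -
  note \<pi>lin = linear_opD[OF \<pi>D(2)]
  have "linear_op D D (lift g)" for g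
    unfolding linear_op_def by (auto simp: lift_closed fun_eq_iff lift_def[of _ _ "_ :: nat"] \<pi>lin)
  moreover have "hnorm D (lift g x) \<le> norm g * hnorm D x" if "x \<in> carrier D" for g x
    using that by (intro dilation_norm_leI lift_closed lift_coord_norm)
  ultimately have "bounded_op D (lift g)" for g
    unfolding bounded_op_def by blast
  moreover have "cinner D (lift (star g) x) y = cinner D x (lift g y)"
    if x: "x \<in> carrier D" and y: "y \<in> carrier D" for g x y
  proof (rule dilation_cinner_eqI[OF lift_closed[OF x] y])
    have "cinner H (lift (star g) x n) (y n) = cinner H (x n) (lift g y n)" for n
      using \<pi>D(7)[OF dilation_in_H[OF x] dilation_in_H[OF y]] by (simp add: lift_def)
    then show "(\<lambda>n. cinner H (lift (star g) x n) (y n)) \<longlonglongrightarrow> cinner D x (lift g y)"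
      using dilation_cinner_lim[OF x lift_closed[OF y]] by simp
  qed
  ultimately show ?thesis
    unfolding star_representation_def
    by (auto simp: fun_eq_iff lift_def[of _ _ "_ :: nat"] \<pi>D(4,5,6))
qed

lemma lift_emb:
  assumes h: "h \<in> carrier H" shows "lift g (emb h) = emb (\<pi> g h)"
proof
  fix n
  have "\<pi> ((\<alpha> ^^ n) g) ((S ^^ n) h) = (S ^^ n) (\<pi> g h)"
  proof (induction n)
    case (Suc n)
    have "\<pi> (\<alpha> ((\<alpha> ^^ n) g)) (S ((S ^^ n) h)) = S (\<pi> ((\<alpha> ^^ n) g) ((S ^^ n) h))"
      using cov h by (simp add: covariant_def)
    then show ?case using Suc by simp
  qed simp
  then show "lift g (emb h) n = emb (\<pi> g h) n" by (simp add: lift_def)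
qed

text \<open>Covariance in the dilation: the additional \<alpha> accounts for the change of index
  from n to n + 1.\<close>

lemma lift_shift: "shift (lift g x) = lift (\<alpha> g) (shift x)"
  by (rule ext) (simp add: lift_def funpow_swap1)

end

section \<open>Transfer of the representation to an arbitrary minimal extension\<close>

locale covariant_extension = minimal_extension H S K J U + covariant_representation H S \<alpha> \<pi>
  for H :: "'h inner_space" and S and K :: "'k inner_space" and J U
    and \<alpha> :: "'g::cstar_algebra \<Rightarrow> 'g" and \<pi>
begin

text \<open>Worded like the local predicate of the theorem, so that it can be folded in at the
  end.\<close>

definition extends :: "('g \<Rightarrow> 'k \<Rightarrow> 'k) \<Rightarrow> bool"
  where "extends \<rho> \<longleftrightarrow> star_representation K \<rho> \<and>
    (\<forall>g. \<forall>x\<in>carrier H. \<rho> g (J x) = J (\<pi> g x)) \<and> covariant K U \<alpha> \<rho>"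

text \<open>\<open>lift\<close> is conjugated by the unitary \<open>\<Phi>\<close>. Equations in K
  are verified by comparing images in \<open>D\<close>, using that \<open>\<Phi>\<close> is
  injective.\<close>

lemma extension_exists: "\<exists>\<rho>. extends \<rho>"
proof -
  define \<rho> where "\<rho> g y = \<Phi>.Uinv (lift g (\<Phi> y))" for g y
  note L = star_representationD[OF star_representation_lift]
  have lift_\<Phi>: "lift g (\<Phi> y) \<in> carrier D" if "y \<in> carrier K" for g y
    by (rule L(3)[OF \<Phi>_closed[OF that]])
  have \<rho>_closed: "\<rho> g y \<in> carrier K" and \<Phi>_\<rho>: "\<Phi> (\<rho> g y) = lift g (\<Phi> y)"
    if "y \<in> carrier K" for g y
    unfolding \<rho>_def using lift_\<Phi>[OF that] by (rule \<Phi>.inv_closed, rule \<Phi>.U_inv)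
  have eqI: "\<rho> g y = z" if "z \<in> carrier K" "lift g (\<Phi> y) = \<Phi> z" for g y z
    unfolding \<rho>_def that(2) by (rule \<Phi>.inv_U[OF that(1)])
  have bdd: "bounded_op K (\<rho> g)" for g
  proof -
    note Iinv = \<Phi>.unitary_inv[unfolded unitary_op_def, THEN conjunct1]
    have "linear_op K D (\<lambda>y. lift g (\<Phi> y))"
      by (rule linear_op_comp[OF \<Phi>.linear L(2)])
    from linear_op_comp[OF this isometry_opD(1)[OF Iinv]] have "linear_op K K (\<rho> g)"
      unfolding \<rho>_def .
    moreover have "hnorm K (\<rho> g y) \<le> norm g * hnorm K y" if y: "y \<in> carrier K" for y
    proof -
      have "hnorm K (\<rho> g y) = hnorm D (lift g (\<Phi> y))"
        using \<Phi>_norm[OF \<rho>_closed[OF y]] \<Phi>_\<rho>[OF y] by metis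
      also have "\<dots> \<le> norm g * hnorm D (\<Phi> y)"
        by (rule star_representation_contractive[OF D.complex_inner_space_axioms
              star_representation_lift \<Phi>_closed[OF y]])
      finally show ?thesis by (simp add: \<Phi>_norm[OF y])
    qed
    ultimately show ?thesis unfolding bounded_op_def by blast
  qed
  have "star_representation K \<rho>"
    unfolding star_representation_def
  proof (intro conjI allI ballI bdd)
    fix f g c x assume x: "x \<in> carrier K"
    note cl = \<rho>_closed[OF x] \<Phi>_closed[OF x]
    show "\<rho> (f + g) x = \<rho> f x \<oplus>\<^bsub>K\<^esub> \<rho> g x"
      by (rule eqI) (simp_all add: cl L(4) \<Phi>.T_add \<Phi>_\<rho>[OF x])
    show "\<rho> (scaleC c g) x = c \<odot>\<^bsub>K\<^esub> \<rho> g x"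
      by (rule eqI) (simp_all add: cl L(5) \<Phi>.T_smult \<Phi>_\<rho>[OF x] K.smult_in_carrier)
    show "\<rho> (f * g) x = \<rho> f (\<rho> g x)"
      by (rule eqI) (simp_all add: cl L(6) \<Phi>_\<rho>[OF x] \<Phi>_\<rho>[OF cl(1)] \<rho>_closed)
    fix y assume y: "y \<in> carrier K"
    show "cinner K (\<rho> (star g) x) y = cinner K x (\<rho> g y)"
      using \<Phi>.T_cinner[OF cl(1) y, of "star g"] \<Phi>.T_cinner[OF x \<rho>_closed[OF y], of g]
        L(7)[OF \<Phi>_closed[OF x] \<Phi>_closed[OF y], of g]
      by (simp add: \<Phi>_\<rho>[OF x] \<Phi>_\<rho>[OF y])
  qed
  moreover have "\<rho> g (J h) = J (\<pi> g h)" if h: "h \<in> carrier H" for g h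
    by (rule eqI) (simp_all add: \<pi>D(3)[OF h] h \<Phi>_J lift_emb)
  moreover have "covariant K U \<alpha> \<rho>"
    unfolding covariant_def
  proof (intro allI ballI)
    fix g x assume x: "x \<in> carrier K"
    show "U (\<rho> g x) = \<rho> (\<alpha> g) (U x)"
      by (rule eqI[symmetric]) (simp_all add: \<rho>_closed[OF x] \<Phi>_U \<Phi>_\<rho>[OF x] lift_shift)
  qed
  ultimately show ?thesis unfolding extends_def by blast
qed

text \<open>On \<open>U^n y\<close>, which is close to \<open>J h\<close>, two extensions nearly agree; contractivity of the
  representations \<open>\<rho> \<circ> \<alpha>^n\<close> makes this uniform in \<open>n\<close>.\<close>

lemma extension_unique:
  assumes \<rho>: "extends \<rho>" and \<rho>': "extends \<rho>'" and y: "y \<in> carrier K"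
  shows "\<rho> g y = \<rho>' g y"
proof -
  have cl: "\<tau> a x \<in> carrier K" if "extends \<tau>" "x \<in> carrier K" for \<tau> a x
    using that star_representationD(3) by (auto simp: extends_def)
  have pow: "(U ^^ n) (\<tau> g y) = \<tau> ((\<alpha> ^^ n) g) ((U ^^ n) y)" if \<tau>: "extends \<tau>" for \<tau> n
  proof (induction n)
    case (Suc n)
    have "U (\<tau> ((\<alpha> ^^ n) g) ((U ^^ n) y)) = \<tau> (\<alpha> ((\<alpha> ^^ n) g)) (U ((U ^^ n) y))"
      using \<tau> Un_closed[OF y] by (simp add: extends_def covariant_def)
    then show ?case using Suc by simp
  qed simp
  have near: "hnorm K (\<tau> ((\<alpha> ^^ n) g) u \<ominus>\<^bsub>K\<^esub> J (\<pi> ((\<alpha> ^^ n) g) h)) \<le> norm g * hnorm K (u \<ominus>\<^bsub>K\<^esub> J h)"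
    if \<tau>: "extends \<tau>" and u: "u \<in> carrier K" and h: "h \<in> carrier H" for \<tau> n u h
  proof -
    have rep: "star_representation K \<tau>" using \<tau> by (simp add: extends_def)
    have "\<tau> ((\<alpha> ^^ n) g) u \<ominus>\<^bsub>K\<^esub> J (\<pi> ((\<alpha> ^^ n) g) h) = \<tau> ((\<alpha> ^^ n) g) (u \<ominus>\<^bsub>K\<^esub> J h)"
      using linear_op_diff[OF K.complex_inner_space_axioms K.complex_inner_space_axioms
          star_representationD(2)[OF rep] u J.T_closed[OF h], of "(\<alpha> ^^ n) g"] \<tau> h
      by (simp add: extends_def)
    then show ?thesis
      using star_representation_contractive[OF K.complex_inner_space_axioms
          star_representation_endomorphism[OF star_endomorphism_funpow[OF endo] rep],
          of "u \<ominus>\<^bsub>K\<^esub> J h" n g] u h by simp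
  qed
  have "hnorm K (\<rho> g y \<ominus>\<^bsub>K\<^esub> \<rho>' g y) \<le> 0"
  proof (rule field_le_epsilon)
    fix e :: real assume "0 < e"
    \<comment> \<open>Each of the two extensions contributes an error of at most norm g * d; the
      added 1 keeps the denominator positive when g = 0.\<close>
    define d where "d = e / (2 * (norm g + 1))"
    have "0 < norm g + 1" by (simp add: add_nonneg_pos)
    then have d: "0 < d" "2 * (norm g + 1) * d = e" using \<open>0 < e\<close> by (simp_all add: d_def)
    obtain n h where h: "h \<in> carrier H" and n: "hnorm K ((U ^^ n) y \<ominus>\<^bsub>K\<^esub> J h) < d"
      using dense[OF y d(1)] .
    let ?u = "(U ^^ n) y" and ?a = "(\<alpha> ^^ n) g"
    have u: "?u \<in> carrier K" using y by simp
    have Jh: "J (\<pi> ?a h) \<in> carrier K" using \<pi>D(3)[OF h] by simp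
    have "(U ^^ n) (\<rho> g y \<ominus>\<^bsub>K\<^esub> \<rho>' g y) = \<rho> ?a ?u \<ominus>\<^bsub>K\<^esub> \<rho>' ?a ?u"
      using Un_diff[OF cl[OF \<rho> y] cl[OF \<rho>' y]] pow[OF \<rho>] pow[OF \<rho>'] by simp
    then have "hnorm K (\<rho> g y \<ominus>\<^bsub>K\<^esub> \<rho>' g y) = hnorm K (\<rho> ?a ?u \<ominus>\<^bsub>K\<^esub> \<rho>' ?a ?u)"
      using Un_norm[OF K.M.minus_closed[OF cl[OF \<rho> y] cl[OF \<rho>' y]]] by metis
    also have "\<dots> \<le> hnorm K (\<rho> ?a ?u \<ominus>\<^bsub>K\<^esub> J (\<pi> ?a h)) + hnorm K (\<rho>' ?a ?u \<ominus>\<^bsub>K\<^esub> J (\<pi> ?a h))"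
      using K.hnorm_diff_triangle[OF cl[OF \<rho> u] Jh cl[OF \<rho>' u]]
        K.hnorm_diff_commute[OF cl[OF \<rho>' u] Jh] by simp
    also have "\<dots> \<le> 2 * (norm g * hnorm K (?u \<ominus>\<^bsub>K\<^esub> J h))"
      using near[OF \<rho> u h] near[OF \<rho>' u h] by (smt (verit))
    also have "\<dots> \<le> 2 * (norm g * d)" using n by (simp add: mult_left_mono)
    also have "\<dots> \<le> 2 * (norm g + 1) * d" using d(1) by (simp add: algebra_simps)
    finally show "hnorm K (\<rho> g y \<ominus>\<^bsub>K\<^esub> \<rho>' g y) \<le> 0 + e" using d(2) by simp
  qed
  then have "hnorm K (\<rho> g y \<ominus>\<^bsub>K\<^esub> \<rho>' g y) = 0"
    using K.hnorm_nonneg[OF K.M.minus_closed[OF cl[OF \<rho> y] cl[OF \<rho>' y]]] by (rule antisym)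
  then show ?thesis
    using K.hnorm_eq_zero[OF K.M.minus_closed[OF cl[OF \<rho> y] cl[OF \<rho>' y]]]
      K.diff_eq_zero[OF cl[OF \<rho> y] cl[OF \<rho>' y]] by simp
qed

end

theorem theorem3p7:
  fixes H :: "'h inner_space" and S :: "'h \<Rightarrow> 'h"
  assumes "hilbert_space H" and "isometry_op H H S"
  shows
    "(\<exists>(K :: (nat \<Rightarrow> 'h) inner_space) J U. minimal_unitary_extension H S K J U) \<and>
     (\<forall>(K\<^sub>1 :: 'k inner_space) J\<^sub>1 U\<^sub>1 (K\<^sub>2 :: 'l inner_space) J\<^sub>2 U\<^sub>2.
        minimal_unitary_extension H S K\<^sub>1 J\<^sub>1 U\<^sub>1 \<and> minimal_unitary_extension H S K\<^sub>2 J\<^sub>2 U\<^sub>2 \<longrightarrow>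
        (\<exists>W. unitary_op K\<^sub>1 K\<^sub>2 W \<and>
             (\<forall>x\<in>carrier H. W (J\<^sub>1 x) = J\<^sub>2 x) \<and>
             (\<forall>y\<in>carrier K\<^sub>1. W (U\<^sub>1 y) = U\<^sub>2 (W y)))) \<and>
     (\<forall>(K :: 'k inner_space) J U (\<alpha> :: 'g::cstar_algebra \<Rightarrow> 'g) \<pi>.
        minimal_unitary_extension H S K J U \<and>
        star_endomorphism \<alpha> \<and> star_representation H \<pi> \<and> covariant H S \<alpha> \<pi> \<longrightarrow>
        (let extends = (\<lambda>\<pi>'. star_representation K \<pi>' \<and>
                             (\<forall>g. \<forall>x\<in>carrier H. \<pi>' g (J x) = J (\<pi> g x)) \<and>
                             covariant K U \<alpha> \<pi>')
         in (\<exists>\<pi>'. extends \<pi>') \<and>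
            (\<forall>\<rho> \<sigma>. extends \<rho> \<and> extends \<sigma> \<longrightarrow> (\<forall>g. \<forall>y\<in>carrier K. \<rho> g y = \<sigma> g y))))"
proof (intro conjI allI impI)
  interpret H: hilbert_space H by fact
  interpret hilbert_endo_isometry H S
    by unfold_locales fact
  show "\<exists>(K :: (nat \<Rightarrow> 'h) inner_space) J U. minimal_unitary_extension H S K J U"
    using minimal_unitary_extension_dilation by blast
  {
    fix K\<^sub>1 :: "'k inner_space" and J\<^sub>1 U\<^sub>1 and K\<^sub>2 :: "'l inner_space" and J\<^sub>2 U\<^sub>2
    assume *: "minimal_unitary_extension H S K\<^sub>1 J\<^sub>1 U\<^sub>1 \<and> minimal_unitary_extension H S K\<^sub>2 J\<^sub>2 U\<^sub>2"
    show "\<exists>W. unitary_op K\<^sub>1 K\<^sub>2 W \<and> (\<forall>x\<in>carrier H. W (J\<^sub>1 x) = J\<^sub>2 x) \<and>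
             (\<forall>y\<in>carrier K\<^sub>1. W (U\<^sub>1 y) = U\<^sub>2 (W y))"
    proof (rule minimal_unitary_extension_unique)
      show "minimal_extension H S K\<^sub>1 J\<^sub>1 U\<^sub>1" "minimal_extension H S K\<^sub>2 J\<^sub>2 U\<^sub>2"
        by (unfold_locales, use * in blast)+
    qed
  }
  {
    fix K :: "'k inner_space" and J U and \<alpha> :: "'g \<Rightarrow> 'g" and \<pi>
    assume *: "minimal_unitary_extension H S K J U \<and>
        star_endomorphism \<alpha> \<and> star_representation H \<pi> \<and> covariant H S \<alpha> \<pi>"
    then interpret covariant_extension H S K J U \<alpha> \<pi>
      by unfold_locales auto
    show "let extends = (\<lambda>\<pi>'. star_representation K \<pi>' \<and>
                             (\<forall>g. \<forall>x\<in>carrier H. \<pi>' g (J x) = J (\<pi> g x)) \<and>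
                             covariant K U \<alpha> \<pi>')
         in (\<exists>\<pi>'. extends \<pi>') \<and>
            (\<forall>\<rho> \<sigma>. extends \<rho> \<and> extends \<sigma> \<longrightarrow> (\<forall>g. \<forall>y\<in>carrier K. \<rho> g y = \<sigma> g y))"
      unfolding Let_def extends_def[symmetric] using extension_exists extension_unique by blast
  }
qed

end
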